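(* Let $\mu$ be a probability distribution on $\mathcal X=\mathbb{R}^{H}$, let $\nu$ be a probability distribution on $\mathcal Y=\mathbb{R}^{D}$, and let $Q:\mathbb{R}^{H}\to\mathbb{R}^{D}$ be a measurable map such that $Q_{\#}\mu$ and $\nu$ have finite second moments. Assume that there exists a unique optimal transport plan $\pi^{*}$ between $\mu$ and $\nu$ for the $Q$-embedded quadratic cost $c(x,y)=\frac12\|Q(x)-y\|^{2}$, and that it is deterministic, i.e., $\pi^{*}=[\mathrm{id}_{\mathbb{R}^{H}},G^{*}]_{\#}\mu$ for some measurable $G^{*}:\mathbb{R}^{H}\to\mathbb{R}^{D}$ (the OT map from $\mu$ to $\nu$). For $\psi:\mathbb{R}^{D}\to\mathbb{R}$ and $G:\mathbb{R}^{H}\to\mathbb{R}^{D}$ put $$\mathcal{L}(\psi,G)=\int_{\mathcal X}\left\{\langle Q(x),G(x)\rangle-\psi\big(G(x)\big)\right\}d\mu(x)+\int_{\mathcal Y}\psi(y)\,d\nu(y).$$ Let $\hat\psi:\mathbb{R}^{D}\to\mathbb{R}$ be an admissible potential that is $\beta$-strongly convex for some $\beta>0$, and let $\hat G:\mathbb{R}^{H}\to\mathbb{R}^{D}$ be measurable. Define $$\epsilon_{1}=\sup_{G}\mathcal{L}(\hat\psi,G)-\mathcal{L}(\hat\psi,\hat G),\qquad \epsilon_{2}=\sup_{G}\mathcal{L}(\hat\psi,G)-\inf_{\psi}\sup_{G}\mathcal{L}(\psi,G).$$ Then $$\frac{\mathrm{FID}(\hat G_{\#}\mu,\nu)}{L^{2}}\;\le\;2\,\mathcal{W}_{2}^{2}(\hat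 G_{\#}\mu,\nu)\;\le\;\int_{\mathcal X}\|\hat G(x)-G^{*}(x)\|^{2}\,d\mu(x)\;\le\;\frac{2}{\beta}\left(\sqrt{\epsilon_{1}}+\sqrt{\epsilon_{2}}\right)^{2},$$ where $\mathrm{FID}$ is the Fréchet inception distance computed with feature extractor $\mathcal I:\mathbb{R}^{D}\to\mathbb{R}^{m}$ and $L>0$ is the Lipschitz constant of $\mathcal I$.
   Context: Notation: $T_{\#}\mu$ is the pushforward of $\mu$ under $T$; $[\mathrm{id},G]_{\#}\mu$ is the pushforward of $\mu$ under $x\mapsto(x,G(x))$; $\Pi(\mu,\nu)$ is the set of couplings of $\mu$ and $\nu$. An optimal transport plan for a cost $c$ is a minimizer of $\int c(x,y)\,d\pi(x,y)$ over $\pi\in\Pi(\mu,\nu)$. Convention for $\mathcal W_2$ (note the factor $\frac12$): for probability distributions $\alpha,\beta$ on $\mathbb{R}^{D}$, $$\mathcal{W}_{2}^{2}(\alpha,\beta)=\inf_{\pi\in\Pi(\alpha,\beta)}\int\tfrac12\|x-y\|^{2}\,d\pi(x,y)\in[0,+\infty].$$ Admissible potentials $\psi$ are Borel functions $\mathbb{R}^{D}\to\mathbb{R}$ with $\psi\in L^{1}(\nu)$; $\inf_\psi$ is over all admissible potentials. $\sup_G$ is over all measurable maps $G:\mathbb{R}^{H}\to\mathbb{R}^{D}$ (for which the integral defining $\mathcal L$ makes sense in $[-\infty,+\infty]$). The quantities $\epsilon_1,\epsilon_2$ lie in $[0,+\infty]$, and the inequalities are understood in $[0,+\infty]$. A function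 $\hat\psi$ is $\beta$-strongly convex if $\hat\psi-\frac{\beta}{2}\|\cdot\|^{2}$ is convex. FID: $\mathcal I:\mathbb{R}^{D}\to\mathbb{R}^{m}$ is a fixed Lipschitz map (in the source, the feature extractor of the pre-trained InceptionV3 network). For distributions $\alpha,\beta$ on $\mathbb{R}^{D}$ with finite second moments, $\mathrm{FID}(\alpha,\beta)=\mathrm{FD}(\mathcal I_{\#}\alpha,\mathcal I_{\#}\beta)$, where for distributions $\alpha',\beta'$ on $\mathbb{R}^{m}$ with means $m_1,m_2$ and covariance matrices $\Sigma_1,\Sigma_2$, $$\mathrm{FD}(\alpha',\beta')=\|m_1-m_2\|^{2}+\mathrm{tr}\left(\Sigma_1+\Sigma_2-2\left(\Sigma_1^{1/2}\Sigma_2\Sigma_1^{1/2}\right)^{1/2}\right).$$ If $\hat G_{\#}\mu$ does not have a finite second moment, $\mathrm{FID}(\hat G_{\#}\mu,\nu)$ is taken to be $+\infty$. *)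

theory Defs
  imports "HOL-Probability.Probability"
begin

section \<open>Couplings and optimal transport\<close>

definition couplings :: "'a measure \<Rightarrow> 'b measure \<Rightarrow> ('a \<times> 'b) measure set" where
  "couplings \<mu> \<nu> =
     {\<pi>. sets \<pi> = sets (\<mu> \<Otimes>\<^sub>M \<nu>) \<and> distr \<pi> \<mu> fst = \<mu> \<and> distr \<pi> \<nu> snd = \<nu>}"

definition transport_cost :: "('a \<Rightarrow> 'b \<Rightarrow> ennreal) \<Rightarrow> ('a \<times> 'b) measure \<Rightarrow> ennreal" where
  "transport_cost c \<pi> = (\<integral>\<^sup>+ z. c (fst z) (snd z) \<partial>\<pi>)"

definition optimal_plan ::
  "('a \<Rightarrow> 'b \<Rightarrow> ennreal) \<Rightarrow> 'a measure \<Rightarrow> 'b measure \<Rightarrow> ('a \<times> 'b) measure \<Rightarrow> bool" where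
  "optimal_plan c \<mu> \<nu> \<pi> \<longleftrightarrow>
     \<pi> \<in> couplings \<mu> \<nu> \<and>
     (\<forall>\<pi>'\<in>couplings \<mu> \<nu>. transport_cost c \<pi> \<le> transport_cost c \<pi>')"

definition embedded_cost :: "('a \<Rightarrow> 'b::real_normed_vector) \<Rightarrow> 'a \<Rightarrow> 'b \<Rightarrow> ennreal" where
  "embedded_cost Q x y = ennreal ((norm (Q x - y))\<^sup>2 / 2)"

text \<open>Squared Wasserstein-2 distance, normalised with the factor \<open>1/2\<close>.\<close>

definition W2_sq :: "'b::real_normed_vector measure \<Rightarrow> 'b measure \<Rightarrow> ennreal" where
  "W2_sq \<alpha> \<beta> =
     (INF \<pi>\<in>couplings \<alpha> \<beta>. transport_cost (\<lambda>x y. ennreal ((norm (x - y))\<^sup>2 / 2)) \<pi>)"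

definition finite_second_moment :: "'b::real_normed_vector measure \<Rightarrow> bool" where
  "finite_second_moment \<alpha> \<longleftrightarrow> (\<integral>\<^sup>+ x. ennreal ((norm x)\<^sup>2) \<partial>\<alpha>) < \<infinity>"

section \<open>The saddle-point functional\<close>

text \<open>
  Integrals with values in \<open>[-\<infinity>, \<infinity>]\<close>: positive part minus negative part. The value of
  \<open>ext_integral\<close> is meaningful only for a \<open>quasi_integrable\<close> integrand, that is, when at
  least one of the two parts has a finite integral.
\<close>

definition quasi_integrable :: "'a measure \<Rightarrow> ('a \<Rightarrow> real) \<Rightarrow> bool" where
  "quasi_integrable M f \<longleftrightarrow>
     f \<in> borel_measurable M \<and>
     ((\<integral>\<^sup>+ x. ennreal (f x) \<partial>M) < \<infinity> \<or> (\<integral>\<^sup>+ x. ennreal (- f x) \<partial>M) < \<infinity>)"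

definition ext_integral :: "'a measure \<Rightarrow> ('a \<Rightarrow> real) \<Rightarrow> ereal" where
  "ext_integral M f =
     enn2ereal (\<integral>\<^sup>+ x. ennreal (f x) \<partial>M) - enn2ereal (\<integral>\<^sup>+ x. ennreal (- f x) \<partial>M)"

definition admissible_potentials :: "'b::euclidean_space measure \<Rightarrow> ('b \<Rightarrow> real) set" where
  "admissible_potentials \<nu> = {\<psi>. \<psi> \<in> borel_measurable borel \<and> integrable \<nu> \<psi>}"

definition lagrangian ::
  "('a \<Rightarrow> 'b::euclidean_space) \<Rightarrow> 'a measure \<Rightarrow> 'b measure \<Rightarrow> ('b \<Rightarrow> real) \<Rightarrow> ('a \<Rightarrow> 'b) \<Rightarrow> ereal"
  where
  "lagrangian Q \<mu> \<nu> \<psi> G =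
     ext_integral \<mu> (\<lambda>x. Q x \<bullet> G x - \<psi> (G x)) + ereal (\<integral>y. \<psi> y \<partial>\<nu>)"

definition admissible_maps ::
  "('a \<Rightarrow> 'b::euclidean_space) \<Rightarrow> 'a measure \<Rightarrow> ('b \<Rightarrow> real) \<Rightarrow> ('a \<Rightarrow> 'b) set" where
  "admissible_maps Q \<mu> \<psi> =
     {G. G \<in> borel_measurable \<mu> \<and> quasi_integrable \<mu> (\<lambda>x. Q x \<bullet> G x - \<psi> (G x))}"

definition sup_lagrangian ::
  "('a \<Rightarrow> 'b::euclidean_space) \<Rightarrow> 'a measure \<Rightarrow> 'b measure \<Rightarrow> ('b \<Rightarrow> real) \<Rightarrow> ereal" where
  "sup_lagrangian Q \<mu> \<nu> \<psi> = (SUP G\<in>admissible_maps Q \<mu> \<psi>. lagrangian Q \<mu> \<nu> \<psi> G)"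

definition strongly_convex :: "real \<Rightarrow> ('b::real_normed_vector \<Rightarrow> real) \<Rightarrow> bool" where
  "strongly_convex \<beta> \<psi> \<longleftrightarrow> convex_on UNIV (\<lambda>y. \<psi> y - \<beta> / 2 * (norm y)\<^sup>2)"

text \<open>Square root on \<open>[0, \<infinity>]\<close>; the values at negative arguments are irrelevant.\<close>

definition ereal_sqrt :: "ereal \<Rightarrow> ereal" where
  "ereal_sqrt x = (if x = \<infinity> then \<infinity> else ereal (sqrt (real_of_ereal x)))"

section \<open>The Frechet inception distance\<close>

definition mean :: "(real^'m) measure \<Rightarrow> real^'m" where
  "mean \<alpha> = (\<integral>z. z \<partial>\<alpha>)"

definition covariance_matrix :: "(real^'m) measure \<Rightarrow> real^'m^'m" where
  "covariance_matrix \<alpha> =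
     (\<chi> i j. \<integral>z. (z $ i - mean \<alpha> $ i) * (z $ j - mean \<alpha> $ j) \<partial>\<alpha>)"

definition pos_semidef :: "real^'m^'m \<Rightarrow> bool" where
  "pos_semidef A \<longleftrightarrow> transpose A = A \<and> (\<forall>x. 0 \<le> x \<bullet> (A *v x))"

text \<open>The principal square root, for positive semidefinite arguments.\<close>

definition mat_sqrt :: "real^'m^'m \<Rightarrow> real^'m^'m" where
  "mat_sqrt A = (THE B. pos_semidef B \<and> B ** B = A)"

definition FD :: "(real^'m) measure \<Rightarrow> (real^'m) measure \<Rightarrow> real" where
  "FD \<alpha> \<beta> =
     (let S1 = covariance_matrix \<alpha>; S2 = covariance_matrix \<beta>
      in (norm (mean \<alpha> - mean \<beta>))\<^sup>2
         + trace (S1 + S2 - 2 *\<^sub>R mat_sqrt (mat_sqrt S1 ** S2 ** mat_sqrt S1)))"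

definition FID ::
  "('b::euclidean_space \<Rightarrow> real^'m) \<Rightarrow> 'b measure \<Rightarrow> 'b measure \<Rightarrow> ereal" where
  "FID feat \<alpha> \<beta> =
     (if finite_second_moment \<alpha> \<and> finite_second_moment \<beta>
      then ereal (FD (distr \<alpha> borel feat) (distr \<beta> borel feat)) else \<infinity>)"

end

theory Submission
  imports Defs
begin

text \<open>
  For a coupling of \<open>\<alpha>\<close> and \<open>\<beta>\<close>, pushing both coordinates through the Lipschitz map
  reduces the first inequality to the bound \<open>FD \<le> E \<parallel>X - Y\<parallel>\<^sup>2\<close>, where the cross covariance
  is controlled by the spectral theorem. The second inequality uses the coupling
  \<open>(Ghat, Gstar)\<close>.

  For the third, let \<open>P q\<close> maximise \<open>q \<bullet> y - \<psi>hat y\<close> and put \<open>G0 x = P (Q x)\<close>. By strong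
  convexity, replacing \<open>G0\<close> by another map \<open>G\<close> lowers the Lagrangian by at least
  \<open>\<beta> / 2\<close> times the squared \<open>L\<^sup>2\<close> distance of \<open>G\<close> and \<open>G0\<close>. For \<open>G = Ghat\<close> the loss is at most
  \<open>\<epsilon>1\<close>. For \<open>G = Gstar\<close> the Lagrangian is the expectation of \<open>Q x \<bullet> Gstar x\<close>, which dominates the
  saddle value by Kantorovich duality, so that the loss is at most \<open>\<epsilon>2\<close>. Duality
  holds because the support of \<open>(Q, Gstar)\<close> is cyclically monotone: otherwise exchanging small
  pieces of mass along a cycle would beat the optimal plan.
\<close>

section \<open>Symmetric matrices and their square roots\<close>

text \<open>Optimality is known only among plans on the original spaces, whereas cyclical
  monotonicity concerns the pairs \<open>(Q x, Gstar x)\<close>. As \<open>Q\<close> may be neither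
  injective nor continuous, competitors are built on the original spaces, from sets of points
  \<open>x\<close> whose pair lies near a prescribed one; a product measure takes the place of a
  rearrangement map. The quadratic cost turns into an inner product because the square terms cancel
  around a cycle. In the Lagrangian at \<open>Gstar\<close> the potential drops out, since
  \<open>Gstar\<close> pushes \<mu> to \<nu>. Neither \<open>Ghat\<close> nor
  \<open>\<psi>hat\<close> along \<open>Ghat\<close> is assumed integrable, so each bound is split:
  an infinite right-hand side is trivial, and a finite one yields the integrability that the
  computation requires. The two distances from \<open>G0\<close> are joined by Minkowski's
  inequality; hence the square of a sum of roots, with \<open>2 / \<beta>\<close> as the inverse of
  the growth constant \<open>\<beta> / 2\<close>.\<close>

text \<open>A maximiser \<open>v\<close> of the Rayleigh quotient on the unit sphere of
  \<open>S\<close> works. The form \<open>B\<close> is nonnegative on \<open>S\<close> and vanishes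
  at \<open>v\<close>; moving from \<open>v\<close> against the residual
  \<open>u = c *\<^sub>R v - f v\<close> would make it negative unless \<open>u = 0\<close>.\<close>

lemma selfadjoint_eigenvector:
  fixes f :: "'a::euclidean_space \<Rightarrow> 'a"
  assumes lin: "linear f" and sym: "\<And>x y. f x \<bullet> y = x \<bullet> f y"
    and S: "subspace S" "S \<noteq> {0}" and inv: "\<And>x. x \<in> S \<Longrightarrow> f x \<in> S"
  obtains v c where "v \<in> S" "norm v = 1" "f v = c *\<^sub>R v"
proof -
  obtain s where s: "s \<in> S" "s \<noteq> 0" using S subspace_0 by blast
  let ?K = "sphere 0 1 \<inter> S"
  have "compact ?K" using closed_subspace[OF S(1)] by (intro compact_Int_closed) auto
  moreover have "s /\<^sub>R norm s \<in> ?K" using s S(1) by (simp add: subspace_scale)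
  moreover have "continuous_on ?K (\<lambda>x. x \<bullet> f x)"
    using lin by (intro continuous_intros linear_continuous_on) (simp add: linear_conv_bounded_linear)
  ultimately obtain v where v: "v \<in> S" "norm v = 1"
    and max: "\<And>x. x \<in> S \<Longrightarrow> norm x = 1 \<Longrightarrow> x \<bullet> f x \<le> v \<bullet> f v"
    using continuous_attains_sup[of ?K "\<lambda>x. x \<bullet> f x"]
    by (metis (mono_tags, lifting) IntD1 IntD2 IntI dist_0_norm empty_iff mem_sphere)
  define c where "c = v \<bullet> f v"
  define B where "B w = c * (w \<bullet> w) - w \<bullet> f w" for w
  have B_nonneg: "0 \<le> B w" if "w \<in> S" for w
  proof (cases "w = 0")
    case False
    define u where "u = w /\<^sub>R norm w"
    have u: "u \<in> S" "norm u = 1" using False that S(1) by (simp_all add: u_def subspace_scale)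
    have wu: "w = norm w *\<^sub>R u" using False by (simp add: u_def)
    have "w \<bullet> f w = (norm w)\<^sup>2 * (u \<bullet> f u)"
      by (subst (1 2) wu) (simp add: linear_scale[OF lin] power2_eq_square)
    also have "\<dots> \<le> (norm w)\<^sup>2 * c" using max[OF u] by (simp add: c_def mult_left_mono)
    finally show ?thesis by (simp add: B_def power2_norm_eq_inner mult.commute)
  qed (simp add: B_def)
  define u where "u = c *\<^sub>R v - f v"
  have uS: "u \<in> S" using v inv S(1) by (simp add: u_def subspace_scale subspace_diff)
  have key: "B (v - t *\<^sub>R u) = t\<^sup>2 * B u - 2 * t * (u \<bullet> u)" for t
  proof -
    have fv: "f v = c *\<^sub>R v - u" by (simp add: u_def)
    have vv: "v \<bullet> v = 1" using v(2) by (simp add: norm_eq_1)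
    have "v \<bullet> f v = c" by (simp add: c_def)
    then have vu: "v \<bullet> u = 0" by (simp add: fv inner_diff_right vv)
    have vfu: "v \<bullet> f u = - (u \<bullet> u)"
      by (metis sym fv inner_diff_left inner_scaleR_left vu mult_zero_right diff_0)
    show ?thesis
      by (simp add: B_def linear_diff[OF lin] linear_scale[OF lin] inner_diff_left inner_diff_right
          vv vu vfu inner_commute[of u v] fv algebra_simps power2_eq_square)
  qed
  have "u = 0"
  proof (rule ccontr)
    assume "u \<noteq> 0"
    then have pos: "u \<bullet> u > 0" by simp
    \<comment> \<open>This \<open>t\<close> keeps the quadratic term of \<open>key\<close> at most
      half of the linear one; the \<open>+ 1\<close> keeps the denominator positive when
      \<open>B u = 0\<close>.\<close>
    define t where "t = (u \<bullet> u) / (B u + 1)"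
    have t: "t > 0" using pos B_nonneg[OF uS] by (simp add: t_def)
    have "t * B u \<le> u \<bullet> u"
      using B_nonneg[OF uS] pos by (simp add: t_def field_simps)
    moreover have "0 \<le> B (v - t *\<^sub>R u)" using v uS S(1) by (intro B_nonneg) (simp add: subspace_scale subspace_diff)
    ultimately have "t * (2 * (u \<bullet> u)) \<le> t * (u \<bullet> u)"
      using t mult_left_mono[of "t * B u" "u \<bullet> u" t] by (simp add: key power2_eq_square algebra_simps)
    then show False using t pos by simp
  qed
  then have "f v = c *\<^sub>R v" by (simp add: u_def)
  with v show ?thesis by (rule that)
qed

definition orthonormal_basis :: "'a::euclidean_space set \<Rightarrow> bool" where
  "orthonormal_basis E \<longleftrightarrow> finite E \<and> pairwise orthogonal E \<and> (\<forall>e\<in>E. norm e = 1) \<and> span E = UNIV"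

text \<open>By symmetry the orthogonal complement of an eigenvector inside \<open>S\<close> is again
  invariant, which permits induction on the dimension over all invariant subspaces.\<close>

lemma selfadjoint_eigenbasis_subspace:
  fixes f :: "'a::euclidean_space \<Rightarrow> 'a"
  assumes lin: "linear f" and sym: "\<And>x y. f x \<bullet> y = x \<bullet> f y"
  shows "subspace S \<Longrightarrow> (\<And>x. x \<in> S \<Longrightarrow> f x \<in> S) \<Longrightarrow>
    \<exists>E. finite E \<and> pairwise orthogonal E \<and> (\<forall>e\<in>E. norm e = 1) \<and> span E = S
      \<and> (\<forall>e\<in>E. \<exists>c. f e = c *\<^sub>R e)"
proof (induction "dim S" arbitrary: S rule: less_induct)
  case less
  show ?case
  proof (cases "S = {0}")
    case True
    then show ?thesis by (intro exI[of _ "{}"]) auto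
  next
    case False
    from selfadjoint_eigenvector[OF lin sym less.prems(1) False less.prems(2)]
    obtain v c where v: "v \<in> S" "norm v = 1" and fv: "f v = c *\<^sub>R v" by metis
    have vv: "v \<bullet> v = 1" using v(2) by (simp add: norm_eq_1)
    define T where "T = {x \<in> S. v \<bullet> x = 0}"
    have T: "subspace T" using less.prems(1) unfolding T_def subspace_def by (auto simp: inner_add_right)
    have "v \<notin> T" using vv by (simp add: T_def)
    moreover have "T \<subseteq> S" by (auto simp: T_def)
    ultimately have "T \<subset> S" using v(1) by blast
    then have "dim T < dim S"
      using dim_psubset[of T S] less.prems(1) T by (simp add: span_eq_iff[THEN iffD2])
    moreover have "f x \<in> T" if "x \<in> T" for x
      using that less.prems(2) sym[of v x] by (simp add: T_def fv)
    ultimately obtain E where E: "finite E" "pairwise orthogonal E" "\<forall>e\<in>E. norm e = 1"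
      "span E = T" "\<forall>e\<in>E. \<exists>c. f e = c *\<^sub>R e"
      using less.hyps[OF _ T] by blast
    have ET: "E \<subseteq> T" using E(4) span_superset by blast
    have "span (insert v E) = S"
    proof
      show "span (insert v E) \<subseteq> S"
        using less.prems(1) v ET by (intro span_minimal) (auto simp: T_def)
      show "S \<subseteq> span (insert v E)"
      proof
        fix x assume x: "x \<in> S"
        have "x - (v \<bullet> x) *\<^sub>R v \<in> span E"
          using x v less.prems(1) vv by (simp add: E(4) T_def subspace_diff subspace_scale inner_diff_right)
        then show "x \<in> span (insert v E)" by (auto simp: span_breakdown_eq)
      qed
    qed
    moreover have "pairwise orthogonal (insert v E)"
      using E(2) ET by (auto simp: pairwise_insert T_def orthogonal_def inner_commute)
    ultimately show ?thesis using E v fv by (intro exI[of _ "insert v E"]) auto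
  qed
qed

lemma symmetric_matrix_inner:
  fixes M :: "real^'m^'m"
  assumes "transpose M = M"
  shows "(M *v x) \<bullet> y = x \<bullet> (M *v y)"
  using assms by (metis dot_lmul_matrix vector_transpose_matrix)

lemma symmetric_matrix_eigenbasis:
  fixes M :: "real^'m^'m"
  assumes "transpose M = M"
  obtains E l where "orthonormal_basis E" "\<And>e. e \<in> E \<Longrightarrow> M *v e = l e *\<^sub>R e"
proof -
  obtain E where "orthonormal_basis E" "\<forall>e\<in>E. \<exists>c. M *v e = c *\<^sub>R e"
    using selfadjoint_eigenbasis_subspace[OF matrix_vector_mul_linear symmetric_matrix_inner[OF assms],
        of UNIV] unfolding orthonormal_basis_def by auto
  then show ?thesis using that[of E "\<lambda>e. SOME c. M *v e = c *\<^sub>R e"]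
    by (metis (mono_tags, lifting) someI_ex)
qed

section \<open>Expansions, traces and functional calculus in an orthonormal basis\<close>

lemma orthonormal_basis_inner:
  "orthonormal_basis E \<Longrightarrow> a \<in> E \<Longrightarrow> b \<in> E \<Longrightarrow> a \<bullet> b = (if a = b then 1 else 0)"
  by (auto simp: orthonormal_basis_def pairwise_def orthogonal_def norm_eq_1)

lemma orthonormal_basis_expand_vector:
  assumes "orthonormal_basis E"
  shows "(\<Sum>e\<in>E. (e \<bullet> x) *\<^sub>R e) = x"
proof -
  have fin: "finite E" using assms by (simp add: orthonormal_basis_def)
  have "x \<in> span E" using assms by (simp add: orthonormal_basis_def)
  then obtain u where x: "x = (\<Sum>e\<in>E. u e *\<^sub>R e)" using span_finite[OF fin] by auto
  have "e \<bullet> x = u e" if "e \<in> E" for e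
    using that fin by (simp add: x inner_sum_right orthonormal_basis_inner[OF assms that] if_distrib[of "\<lambda>t. _ * t"] sum.delta' cong: sum.cong if_cong)
  then show ?thesis by (subst x) (auto intro!: sum.cong)
qed

lemma orthonormal_basis_matrix_eqI:
  fixes M N :: "real^'m^'m"
  assumes "orthonormal_basis E" "\<And>e. e \<in> E \<Longrightarrow> M *v e = N *v e"
  shows "M = N"
proof -
  have "M *v x = N *v x" for x
    by (subst (1 2) orthonormal_basis_expand_vector[OF assms(1), symmetric])
       (simp add: linear_sum[OF matrix_vector_mul_linear] matrix_vector_mult_scaleR assms(2) cong: sum.cong)
  then show ?thesis by (simp add: matrix_eq)
qed

lemma trace_orthonormal_basis:
  fixes M :: "real^'m^'m"
  assumes "orthonormal_basis E"
  shows "trace M = (\<Sum>e\<in>E. e \<bullet> (M *v e))"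
proof -
  \<comment> \<open>Completeness relation of the basis, read off from the expansion of a coordinate
    vector.\<close>
  have delta: "(\<Sum>e\<in>E. e $ i * e $ j) = (if j = i then 1 else 0)" for i j
    using arg_cong[OF orthonormal_basis_expand_vector[OF assms, of "axis i 1"], of "\<lambda>x. x $ j"]
    by (simp add: inner_axis sum_component) (simp add: axis_def)
  have "(\<Sum>e\<in>E. e \<bullet> (M *v e)) = (\<Sum>e\<in>E. \<Sum>i\<in>UNIV. \<Sum>j\<in>UNIV. M $ i $ j * (e $ i * e $ j))"
    by (simp add: inner_vec_def matrix_vector_mult_def sum_distrib_left mult_ac)
  also have "\<dots> = (\<Sum>i\<in>UNIV. \<Sum>e\<in>E. \<Sum>j\<in>UNIV. M $ i $ j * (e $ i * e $ j))" by (rule sum.swap)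
  also have "\<dots> = (\<Sum>i\<in>UNIV. \<Sum>j\<in>UNIV. \<Sum>e\<in>E. M $ i $ j * (e $ i * e $ j))"
    by (intro sum.cong refl sum.swap)
  also have "\<dots> = trace M"
    by (simp add: delta flip: sum_distrib_left) (simp add: trace_def if_distrib[of "\<lambda>t. _ * t"] cong: if_cong)
  finally show ?thesis ..
qed

text \<open>Functional calculus: with an eigenbasis \<open>E\<close> of a matrix, \<open>g\<close>
  prescribes the new eigenvalues. It produces both square roots and pseudo-inverses.\<close>

definition spectral_matrix :: "(real^'m) set \<Rightarrow> (real^'m \<Rightarrow> real) \<Rightarrow> real^'m^'m" where
  "spectral_matrix E g = matrix (\<lambda>x. \<Sum>e\<in>E. (g e * (e \<bullet> x)) *\<^sub>R e)"

lemma spectral_matrix_mult: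
  "spectral_matrix E g *v x = (\<Sum>e\<in>E. (g e * (e \<bullet> x)) *\<^sub>R e)"
proof -
  have "linear (\<lambda>x. \<Sum>e\<in>E. (g e * (e \<bullet> x)) *\<^sub>R e)"
    by (intro linearI) (simp_all add: inner_add_right algebra_simps sum.distrib scaleR_sum_right)
  then show ?thesis by (simp add: spectral_matrix_def matrix_works)
qed

lemma spectral_matrix_eigenvector:
  assumes "orthonormal_basis E" "e \<in> E"
  shows "spectral_matrix E g *v e = g e *\<^sub>R e"
proof -
  have "finite E" using assms by (simp add: orthonormal_basis_def)
  moreover have "(g a * (a \<bullet> e)) *\<^sub>R a = (if a = e then g e *\<^sub>R e else 0)" if "a \<in> E" for a
    using orthonormal_basis_inner[OF assms(1) that assms(2)] by auto
  ultimately show ?thesis using assms(2) by (simp add: spectral_matrix_mult cong: sum.cong)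
qed

lemma spectral_matrix_symmetric: "transpose (spectral_matrix E g) = spectral_matrix E g"
proof -
  have "x \<bullet> (transpose (spectral_matrix E g) *v y) = (spectral_matrix E g *v x) \<bullet> y" for x y
    by (metis dot_lmul_matrix vector_transpose_matrix transpose_transpose)
  also have "(spectral_matrix E g *v x) \<bullet> y = x \<bullet> (spectral_matrix E g *v y)" for x y
    by (simp add: spectral_matrix_mult inner_sum_left inner_sum_right inner_commute[of x] mult_ac)
  finally have "x \<bullet> (transpose (spectral_matrix E g) *v y) = x \<bullet> (spectral_matrix E g *v y)" for x y .
  then show ?thesis by (metis matrix_eq vector_eq_ldot)
qed

lemma spectral_matrix_pos_semidef:
  assumes "\<And>e. e \<in> E \<Longrightarrow> 0 \<le> g e"
  shows "pos_semidef (spectral_matrix E g)"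
  unfolding pos_semidef_def
proof (intro conjI allI)
  show "0 \<le> x \<bullet> (spectral_matrix E g *v x)" for x
    using assms by (auto simp: spectral_matrix_mult inner_sum_right inner_commute[of x] mult.assoc intro!: sum_nonneg)
qed (rule spectral_matrix_symmetric)

section \<open>Square roots of positive semidefinite matrices\<close>

text \<open>Factor \<open>B ** B - l\<^sup>2\<close> as \<open>(B + l) (B - l)\<close>: the vector
  \<open>w = (B - l) v\<close> satisfies \<open>B w = - l w\<close>, so positivity of
  \<open>B\<close> forces \<open>w = 0\<close> if \<open>l > 0\<close>. For \<open>l = 0\<close> the
  squared norm of \<open>B v\<close> is \<open>v \<bullet> B (B v) = 0\<close>.\<close>

lemma pos_semidef_sqrt_eigenvector:
  assumes "pos_semidef B" and BB: "(B ** B) *v v = (l\<^sup>2) *\<^sub>R v" and "0 \<le> l"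
  shows "B *v v = l *\<^sub>R v"
proof -
  have sym: "(B *v x) \<bullet> y = x \<bullet> (B *v y)" for x y
    using assms(1) by (intro symmetric_matrix_inner) (simp add: pos_semidef_def)
  define w where "w = B *v v - l *\<^sub>R v"
  have Bw: "B *v w = - (l *\<^sub>R w)"
    using BB by (simp add: w_def matrix_vector_mult_diff_distrib matrix_vector_mult_scaleR
        matrix_vector_mul_assoc scaleR_diff_right power2_eq_square)
  have "w = 0"
  proof (cases "l = 0")
    case True
    then have "(B *v v) \<bullet> (B *v v) = 0"
      using BB by (simp add: sym matrix_vector_mul_assoc)
    then show ?thesis using True by (simp add: w_def)
  next
    case False
    have "0 \<le> w \<bullet> (B *v w)" using assms(1) by (simp add: pos_semidef_def)
    then have "l * (w \<bullet> w) \<le> 0" by (simp add: Bw)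
    then show ?thesis using False \<open>0 \<le> l\<close>
      by (metis inner_eq_zero_iff inner_ge_zero less_eq_real_def mult_pos_pos not_less order_antisym)
  qed
  then show ?thesis by (simp add: w_def)
qed

text \<open>This gives meaning to the definite description in \<open>mat_sqrt\<close>. Uniqueness
  holds because every positive semidefinite root is determined on an eigenbasis of \<open>A\<close>
  by the preceding lemma.\<close>

lemma mat_sqrt_unique_exists:
  assumes A: "pos_semidef A"
  shows "\<exists>!B. pos_semidef B \<and> B ** B = A"
proof -
  obtain E l where E: "orthonormal_basis E" and l: "\<And>e. e \<in> E \<Longrightarrow> A *v e = l e *\<^sub>R e"
    using A symmetric_matrix_eigenbasis unfolding pos_semidef_def by metis
  have l_nonneg: "0 \<le> l e" if "e \<in> E" for e
  proof -
    have "0 \<le> e \<bullet> (A *v e)" using A by (simp add: pos_semidef_def)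
    then show ?thesis using that by (simp add: l orthonormal_basis_inner[OF E])
  qed
  show ?thesis
  proof (rule ex1I)
    show "pos_semidef (spectral_matrix E (\<lambda>e. sqrt (l e)))
      \<and> spectral_matrix E (\<lambda>e. sqrt (l e)) ** spectral_matrix E (\<lambda>e. sqrt (l e)) = A"
      using E l_nonneg
      by (auto intro!: spectral_matrix_pos_semidef orthonormal_basis_matrix_eqI[OF E]
          simp: l spectral_matrix_eigenvector matrix_vector_mult_scaleR simp flip: matrix_vector_mul_assoc)
  next
    fix B assume B: "pos_semidef B \<and> B ** B = A"
    show "B = spectral_matrix E (\<lambda>e. sqrt (l e))"
    proof (rule orthonormal_basis_matrix_eqI[OF E])
      fix e assume e: "e \<in> E"
      then show "B *v e = spectral_matrix E (\<lambda>e. sqrt (l e)) *v e"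
        using pos_semidef_sqrt_eigenvector[of B e "sqrt (l e)"] B l_nonneg[OF e] l[OF e]
        by (simp add: spectral_matrix_eigenvector[OF E])
    qed
  qed
qed

lemma mat_sqrt:
  assumes "pos_semidef A"
  shows "pos_semidef (mat_sqrt A)" "mat_sqrt A ** mat_sqrt A = A"
  using theI'[OF mat_sqrt_unique_exists[OF assms]] by (simp_all add: mat_sqrt_def)

text \<open>With \<open>A = mat_sqrt S1\<close>, pseudo-inverse \<open>J\<close> of \<open>A\<close>, and an eigenbasis \<open>e\<close> of
  \<open>N = mat_sqrt (A ** S2 ** A)\<close>, the trace of \<open>C\<close> equals \<open>\<Sum> J e \<bullet> C (A e)\<close>, and each term
  is at most the eigenvalue of \<open>N\<close> at \<open>e\<close>.\<close>

lemma trace_cross_covariance_le: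
  fixes S1 S2 C :: "real^'m^'m"
  assumes S1: "pos_semidef S1" and S2: "pos_semidef S2"
    and C: "\<And>u v. (u \<bullet> (C *v v))\<^sup>2 \<le> (u \<bullet> (S1 *v u)) * (v \<bullet> (S2 *v v))"
  shows "trace C \<le> trace (mat_sqrt (mat_sqrt S1 ** S2 ** mat_sqrt S1))"
proof -
  define A where "A = mat_sqrt S1"
  have A: "pos_semidef A" and AA: "A ** A = S1" using mat_sqrt[OF S1] by (simp_all add: A_def)
  have symA: "(A *v x) \<bullet> y = x \<bullet> (A *v y)" for x y
    using A by (intro symmetric_matrix_inner) (simp add: pos_semidef_def)
  have AS: "pos_semidef (A ** S2 ** A)"
    using A S2 unfolding pos_semidef_def
    by (auto simp: matrix_transpose_mul matrix_mul_assoc symA[symmetric] simp flip: matrix_vector_mul_assoc)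
  define N where "N = mat_sqrt (A ** S2 ** A)"
  have N: "pos_semidef N" and NN: "N ** N = A ** S2 ** A" using mat_sqrt[OF AS] by (simp_all add: N_def)
  obtain F a where F: "orthonormal_basis F" and a: "\<And>f. f \<in> F \<Longrightarrow> A *v f = a f *\<^sub>R f"
    using A symmetric_matrix_eigenbasis unfolding pos_semidef_def by metis
  obtain E l where E: "orthonormal_basis E" and l: "\<And>e. e \<in> E \<Longrightarrow> N *v e = l e *\<^sub>R e"
    using N symmetric_matrix_eigenbasis unfolding pos_semidef_def by metis
  \<comment> \<open>Since \<open>1 / 0 = 0\<close>, the matrix \<open>J\<close> vanishes on the
    kernel of \<open>A\<close>, which makes it the pseudo-inverse without a case
    distinction.\<close>
  define J where "J = spectral_matrix F (\<lambda>f. 1 / a f)"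
  have symJ: "(J *v x) \<bullet> y = x \<bullet> (J *v y)" for x y
    by (intro symmetric_matrix_inner) (simp add: J_def spectral_matrix_symmetric)
  have J: "J *v f = (1 / a f) *\<^sub>R f" if "f \<in> F" for f
    using that by (simp add: J_def spectral_matrix_eigenvector[OF F])
  have AJA: "A ** J ** A = A"
    by (rule orthonormal_basis_matrix_eqI[OF F])
       (simp add: a J matrix_vector_mult_scaleR flip: matrix_vector_mul_assoc)
  have AJ: "A ** J = J ** A"
    by (rule orthonormal_basis_matrix_eqI[OF F])
       (simp add: a J matrix_vector_mult_scaleR flip: matrix_vector_mul_assoc)
  \<comment> \<open>\<open>A ** J\<close> is the orthogonal projection onto the range of
    \<open>A\<close>, hence a contraction.\<close>
  have proj: "norm (A *v (J *v x)) \<le> norm x" for x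
  proof -
    have "(A *v (J *v x)) \<bullet> (A *v (J *v x)) = x \<bullet> ((J ** (A ** A ** J)) *v x)"
      by (simp add: symA symJ matrix_mul_assoc flip: matrix_vector_mul_assoc)
    also have "J ** (A ** A ** J) = A ** J" by (metis AJA AJ matrix_mul_assoc)
    finally have "(norm (A *v (J *v x)))\<^sup>2 \<le> norm x * norm (A *v (J *v x))"
      using norm_cauchy_schwarz[of x "A *v (J *v x)"]
      by (simp add: power2_norm_eq_inner matrix_vector_mul_assoc)
    then show ?thesis by (cases "A *v (J *v x) = 0") (auto simp: power2_eq_square)
  qed
  have "trace C = (\<Sum>f\<in>F. f \<bullet> (C *v f))" by (rule trace_orthonormal_basis[OF F])
  also have "\<dots> = (\<Sum>f\<in>F. f \<bullet> ((A ** J ** C) *v f))"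
  proof (rule sum.cong[OF refl])
    fix f assume f: "f \<in> F"
    have "f \<bullet> ((A ** J ** C) *v f) = (J *v (A *v f)) \<bullet> (C *v f)"
      by (simp add: symA symJ flip: matrix_vector_mul_assoc)
    also have "\<dots> = (if a f = 0 then 0 else f \<bullet> (C *v f))"
      using f by (simp add: a J matrix_vector_mult_scaleR)
    also have "\<dots> = f \<bullet> (C *v f)"
    \<comment> \<open>Inserting the projection \<open>A ** J\<close> costs nothing: on the kernel of
      \<open>A\<close> also \<open>S1\<close> vanishes, and then hypothesis \<open>C\<close> forces
      the diagonal entry of \<open>C\<close> to be zero.\<close>
    proof (cases "a f = 0")
      case True
      then have "S1 *v f = 0" using f by (simp add: AA[symmetric] a flip: matrix_vector_mul_assoc)
      then show ?thesis using C[of f f] by simp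
    qed simp
    finally show "f \<bullet> (C *v f) = f \<bullet> ((A ** J ** C) *v f)" ..
  qed
  also have "\<dots> = trace (A ** (J ** C))"
    by (simp add: trace_orthonormal_basis[OF F] matrix_mul_assoc)
  also have "\<dots> = trace (J ** C ** A)" by (rule trace_mul_sym)
  also have "\<dots> = (\<Sum>e\<in>E. (J *v e) \<bullet> (C *v (A *v e)))"
    by (simp add: trace_orthonormal_basis[OF E] symJ flip: matrix_vector_mul_assoc)
  also have "\<dots> \<le> (\<Sum>e\<in>E. l e)"
  proof (rule sum_mono)
    fix e assume e: "e \<in> E"
    have ee: "e \<bullet> e = 1" using orthonormal_basis_inner[OF E e e] by simp
    have "0 \<le> e \<bullet> (N *v e)" using N by (simp add: pos_semidef_def)
    then have l0: "0 \<le> l e" using l[OF e] ee by simp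
    \<comment> \<open>Hypothesis \<open>C\<close> is used at the pair \<open>J e\<close>,
      \<open>A e\<close>: its first factor is bounded by the contraction \<open>proj\<close>, its
      second is the squared eigenvalue of \<open>N\<close>.\<close>
    have "(J *v e) \<bullet> (S1 *v (J *v e)) = (norm (A *v (J *v e)))\<^sup>2"
      by (simp add: power2_norm_eq_inner symA flip: AA matrix_vector_mul_assoc)
    also have "\<dots> \<le> 1" using proj[of e] ee by (simp add: norm_eq_1[symmetric] power_le_one)
    finally have 1: "(J *v e) \<bullet> (S1 *v (J *v e)) \<le> 1" .
    have "(A *v e) \<bullet> (S2 *v (A *v e)) = e \<bullet> ((N ** N) *v e)"
      by (simp add: NN symA flip: matrix_vector_mul_assoc)
    also have "\<dots> = (l e)\<^sup>2"
      using e ee by (simp add: l matrix_vector_mult_scaleR power2_eq_square flip: matrix_vector_mul_assoc)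
    finally have 2: "(A *v e) \<bullet> (S2 *v (A *v e)) = (l e)\<^sup>2" .
    have "((J *v e) \<bullet> (C *v (A *v e)))\<^sup>2 \<le> 1 * (l e)\<^sup>2"
      using C[of "J *v e" "A *v e"] mult_right_mono[OF 1, of "(l e)\<^sup>2"] by (simp add: 2)
    then show "(J *v e) \<bullet> (C *v (A *v e)) \<le> l e" using l0 by (metis abs_le_square_iff abs_of_nonneg abs_le_D1 mult_1)
  qed
  also have "\<dots> = trace N"
    by (simp add: trace_orthonormal_basis[OF E] l orthonormal_basis_inner[OF E] cong: sum.cong)
  finally show ?thesis by (simp add: N_def A_def)
qed

section \<open>The Frechet distance of coupled random vectors\<close>

definition sq_integrable :: "'a measure \<Rightarrow> ('a \<Rightarrow> 'b::euclidean_space) \<Rightarrow> bool" where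
  "sq_integrable M f \<longleftrightarrow> f \<in> borel_measurable M \<and> integrable M (\<lambda>x. (norm (f x))\<^sup>2)"

section \<open>Square-integrable vector-valued functions\<close>

lemma sq_integrable_bound:
  assumes "sq_integrable M f" "g \<in> borel_measurable M" "\<And>x. norm (g x) \<le> c * norm (f x)"
  shows "sq_integrable M g"
proof -
  have "integrable M (\<lambda>x. c\<^sup>2 * (norm (f x))\<^sup>2)" using assms(1) by (simp add: sq_integrable_def)
  moreover have "(\<lambda>x. (norm (g x))\<^sup>2) \<in> borel_measurable M" using assms(2) by measurable
  ultimately have "integrable M (\<lambda>x. (norm (g x))\<^sup>2)"
  proof (rule Bochner_Integration.integrable_bound)
    have "(norm (g x))\<^sup>2 \<le> c\<^sup>2 * (norm (f x))\<^sup>2" for x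
      using power_mono[OF assms(3), of x 2] by (simp add: power_mult_distrib)
    then show "AE x in M. norm ((norm (g x))\<^sup>2) \<le> norm (c\<^sup>2 * (norm (f x))\<^sup>2)" by simp
  qed
  then show ?thesis using assms(2) by (simp add: sq_integrable_def)
qed

lemma sq_integrable_inner_const: "sq_integrable M f \<Longrightarrow> sq_integrable M (\<lambda>x. u \<bullet> f x)"
  by (rule sq_integrable_bound[where c = "norm u"]) (auto simp: sq_integrable_def Cauchy_Schwarz_ineq2)

lemma sq_integrable_component:
  fixes f :: "'a \<Rightarrow> real^'m"
  shows "sq_integrable M f \<Longrightarrow> sq_integrable M (\<lambda>x. f x $ i)"
  using sq_integrable_inner_const[of M f "axis i 1"] by (simp add: inner_axis')

lemma sq_integrable_scaleR: "sq_integrable M f \<Longrightarrow> sq_integrable M (\<lambda>x. c *\<^sub>R f x)"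
  by (rule sq_integrable_bound[where c = "\<bar>c\<bar>"]) (auto simp: sq_integrable_def)

lemma norm_add_sq_le: "(norm (x + y))\<^sup>2 \<le> 2 * (norm x)\<^sup>2 + 2 * (norm (y::'a::real_inner))\<^sup>2"
proof -
  have "0 \<le> (norm (x - y))\<^sup>2" by simp
  then show ?thesis unfolding power2_norm_eq_inner by (simp add: algebra_simps inner_commute)
qed

lemma sq_integrable_add:
  assumes "sq_integrable M f" "sq_integrable M g"
  shows "sq_integrable M (\<lambda>x. f x + g x)"
proof -
  have [measurable]: "f \<in> borel_measurable M" "g \<in> borel_measurable M" using assms by (auto simp: sq_integrable_def)
  have "integrable M (\<lambda>x. 2 * (norm (f x))\<^sup>2 + 2 * (norm (g x))\<^sup>2)"
    using assms by (simp add: sq_integrable_def)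
  then have "integrable M (\<lambda>x. (norm (f x + g x))\<^sup>2)"
    by (rule Bochner_Integration.integrable_bound) (auto intro!: norm_add_sq_le AE_I2)
  then show ?thesis by (simp add: sq_integrable_def)
qed

lemma sq_integrable_diff:
  "sq_integrable M f \<Longrightarrow> sq_integrable M g \<Longrightarrow> sq_integrable M (\<lambda>x. f x - g x)"
  using sq_integrable_add[OF _ sq_integrable_scaleR[of M g "-1"]] by simp

lemma (in finite_measure) sq_integrable_const: "sq_integrable M (\<lambda>x. c)"
  by (simp add: sq_integrable_def)

text \<open>Polarization expresses the product through squared norms, which are integrable.\<close>

lemma integrable_inner_sq_integrable:
  assumes "sq_integrable M f" "sq_integrable M g"
  shows "integrable M (\<lambda>x. f x \<bullet> g x)"
proof -
  have [measurable]: "f \<in> borel_measurable M" "g \<in> borel_measurable M" using assms by (auto simp: sq_integrable_def)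
  have "integrable M (\<lambda>x. ((norm (f x + g x))\<^sup>2 - (norm (f x))\<^sup>2 - (norm (g x))\<^sup>2) / 2)"
    using assms sq_integrable_add[OF assms] by (simp add: sq_integrable_def)
  then show ?thesis
    by (rule Bochner_Integration.integrable_cong[THEN iffD1, rotated -1])
       (auto simp: power2_norm_eq_inner inner_add inner_commute)
qed

lemma (in finite_measure) sq_integrable_integrable:
  assumes "sq_integrable M f" shows "integrable M f"
proof -
  have [measurable]: "f \<in> borel_measurable M" using assms by (auto simp: sq_integrable_def)
  have "integrable M (\<lambda>x. 1 + (norm (f x))\<^sup>2)" using assms by (simp add: sq_integrable_def)
  moreover have "norm (f x) \<le> 1 + (norm (f x))\<^sup>2" for x
    using zero_le_power2[of "norm (f x) - 1"] norm_ge_zero[of "f x"]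
    by (simp add: power2_eq_square algebra_simps del: norm_ge_zero)
  ultimately show ?thesis
    by (elim Bochner_Integration.integrable_bound) auto
qed

lemma sq_integrable_iff_nn_integral:
  assumes "f \<in> borel_measurable M"
  shows "sq_integrable M f \<longleftrightarrow> (\<integral>\<^sup>+ x. ennreal ((norm (f x))\<^sup>2) \<partial>M) < \<infinity>"
  using assms by (simp add: sq_integrable_def integrable_iff_bounded)

lemma Cauchy_Schwarz_integral:
  fixes f g :: "'a \<Rightarrow> real"
  assumes f: "sq_integrable M f" and g: "sq_integrable M g"
  shows "(\<integral>x. f x * g x \<partial>M)\<^sup>2 \<le> (\<integral>x. f x * f x \<partial>M) * (\<integral>x. g x * g x \<partial>M)"
proof -
  have I: "integrable M (\<lambda>x. f x * f x)" "integrable M (\<lambda>x. f x * g x)" "integrable M (\<lambda>x. g x * g x)"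
    using integrable_inner_sq_integrable[OF f f] integrable_inner_sq_integrable[OF f g]
      integrable_inner_sq_integrable[OF g g] by simp_all
  define a b c where "a = (\<integral>x. f x * f x \<partial>M)" "b = (\<integral>x. f x * g x \<partial>M)" "c = (\<integral>x. g x * g x \<partial>M)"
  \<comment> \<open>A quadratic polynomial in \<open>t\<close> that is never negative has
    nonpositive discriminant; \<open>t = b / c\<close> is its minimiser.\<close>
  have quad: "0 \<le> a - 2 * t * b + t\<^sup>2 * c" for t
  proof -
    have "0 \<le> (\<integral>x. (f x - t * g x)\<^sup>2 \<partial>M)" by simp
    also have "\<dots> = (\<integral>x. f x * f x - 2 * t * (f x * g x) + t\<^sup>2 * (g x * g x) \<partial>M)"
      by (simp add: power2_eq_square algebra_simps)
    also have "\<dots> = a - 2 * t * b + t\<^sup>2 * c"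
      using I by (simp add: a_b_c_def)
    finally show ?thesis .
  qed
  have "b\<^sup>2 \<le> a * c"
  proof (cases "c = 0")
    case True
    have "b = 0"
    proof (rule ccontr)
      assume "b \<noteq> 0"
      \<comment> \<open>For \<open>c = 0\<close> this value of \<open>t\<close> turns the polynomial
        into \<open>a - (a + 1) = -1\<close>.\<close>
      then show False using quad[of "(a + 1) / (2 * b)"] True by simp
    qed
    then show ?thesis using True by simp
  next
    case False
    have "0 \<le> c" by (simp add: a_b_c_def)
    with False have "c > 0" by simp
    then show ?thesis using quad[of "b / c"] by (simp add: field_simps power2_eq_square)
  qed
  then show ?thesis by (simp add: a_b_c_def)
qed

text \<open>For centred \<open>U\<close> and \<open>V\<close> this is the cross covariance, and for
  \<open>U = V\<close> the covariance matrix.\<close>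

definition cross_moment :: "'a measure \<Rightarrow> ('a \<Rightarrow> real^'m) \<Rightarrow> ('a \<Rightarrow> real^'m) \<Rightarrow> real^'m^'m" where
  "cross_moment M U V = (\<chi> i j. \<integral>x. U x $ i * V x $ j \<partial>M)"

lemma integrable_component_mult:
  fixes U V :: "'a \<Rightarrow> real^'m"
  assumes "sq_integrable M U" "sq_integrable M V"
  shows "integrable M (\<lambda>x. U x $ i * V x $ j)"
  using integrable_inner_sq_integrable[OF sq_integrable_component[OF assms(1), of i]
      sq_integrable_component[OF assms(2), of j]]
  by (simp add: inner_real_def)

lemma inner_cross_moment:
  assumes "sq_integrable M U" "sq_integrable M V"
  shows "u \<bullet> (cross_moment M U V *v v) = (\<integral>x. (u \<bullet> U x) * (v \<bullet> V x) \<partial>M)"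
proof -
  note [simp] = integrable_component_mult[OF assms]
  have "(\<integral>x. (u \<bullet> U x) * (v \<bullet> V x) \<partial>M)
      = (\<integral>x. (\<Sum>i\<in>UNIV. \<Sum>j\<in>UNIV. u $ i * v $ j * (U x $ i * V x $ j)) \<partial>M)"
    by (simp add: inner_vec_def sum_product mult_ac)
  also have "\<dots> = (\<Sum>i\<in>UNIV. \<Sum>j\<in>UNIV. u $ i * v $ j * (\<integral>x. U x $ i * V x $ j \<partial>M))"
    by (simp add: Bochner_Integration.integral_sum)
  also have "\<dots> = u \<bullet> (cross_moment M U V *v v)"
    by (simp add: inner_vec_def matrix_vector_mult_def cross_moment_def sum_distrib_left mult_ac)
  finally show ?thesis ..
qed

lemma trace_cross_moment:
  assumes "sq_integrable M U" "sq_integrable M V"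
  shows "trace (cross_moment M U V) = (\<integral>x. U x \<bullet> V x \<partial>M)"
  by (simp add: trace_def cross_moment_def inner_vec_def integrable_component_mult[OF assms])

lemma cross_moment_pos_semidef:
  assumes "sq_integrable M U"
  shows "pos_semidef (cross_moment M U U)"
proof -
  have "transpose (cross_moment M U U) = cross_moment M U U"
    by (simp add: cross_moment_def transpose_def mult.commute)
  then show ?thesis by (simp add: pos_semidef_def inner_cross_moment[OF assms assms])
qed

text \<open>After centring, both sides consist of the squared distance of the means and the two
  variances; they differ only in the cross term, where the trace of the actual cross covariance is
  at most the trace of the matrix root in \<open>FD\<close>.\<close>

lemma (in prob_space) FD_le:
  fixes X Y :: "'a \<Rightarrow> real^'m"
  assumes X: "sq_integrable M X" and Y: "sq_integrable M Y"
  shows "FD (distr M borel X) (distr M borel Y) \<le> (\<integral>x. (norm (X x - Y x))\<^sup>2 \<partial>M)"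
proof -
  have [measurable]: "X \<in> borel_measurable M" "Y \<in> borel_measurable M"
    using X Y by (auto simp: sq_integrable_def)
  define a b where "a = (\<integral>x. X x \<partial>M)" "b = (\<integral>x. Y x \<partial>M)"
  define U V where "U = (\<lambda>x. X x - a)" "V = (\<lambda>x. Y x - b)"
  have U: "sq_integrable M U" and V: "sq_integrable M V"
    using X Y by (auto simp: U_V_def intro!: sq_integrable_diff sq_integrable_const)
  have mean: "mean (distr M borel X) = a" "mean (distr M borel Y) = b"
    by (simp_all add: mean_def integral_distr a_b_def)
  have cov: "covariance_matrix (distr M borel X) = cross_moment M U U"
    "covariance_matrix (distr M borel Y) = cross_moment M V V"
    by (simp_all add: covariance_matrix_def mean cross_moment_def integral_distr U_V_def)
  define R where "R = trace (mat_sqrt (mat_sqrt (cross_moment M U U) ** cross_moment M V V ** mat_sqrt (cross_moment M U U)))"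
  have "trace (cross_moment M U V) \<le> R"
    unfolding R_def
  proof (rule trace_cross_covariance_le)
    fix u v
    show "(u \<bullet> (cross_moment M U V *v v))\<^sup>2
        \<le> (u \<bullet> (cross_moment M U U *v u)) * (v \<bullet> (cross_moment M V V *v v))"
      unfolding inner_cross_moment[OF U V] inner_cross_moment[OF U U] inner_cross_moment[OF V V]
      by (intro Cauchy_Schwarz_integral sq_integrable_inner_const U V)
  qed (auto intro!: cross_moment_pos_semidef U V)
  then have R: "(\<integral>x. U x \<bullet> V x \<partial>M) \<le> R" by (simp add: trace_cross_moment U V)
  have FD: "FD (distr M borel X) (distr M borel Y) =
      (norm (a - b))\<^sup>2 + ((\<integral>x. U x \<bullet> U x \<partial>M) + (\<integral>x. V x \<bullet> V x \<partial>M) - 2 * R)"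
    by (simp add: FD_def Let_def cov mean trace_add trace_sub R_def trace_cross_moment U V)
       (simp add: trace_def sum_distrib_left)
  note I = integrable_inner_sq_integrable[OF U U] integrable_inner_sq_integrable[OF U V]
    integrable_inner_sq_integrable[OF V V] sq_integrable_integrable[OF U] sq_integrable_integrable[OF V]
  have UV0: "(\<integral>x. U x \<partial>M) = 0" "(\<integral>x. V x \<partial>M) = 0"
    using sq_integrable_integrable[OF X] sq_integrable_integrable[OF Y] by (simp_all add: U_V_def a_b_def prob_space)
  have "(\<integral>x. (norm (X x - Y x))\<^sup>2 \<partial>M) = (\<integral>x. U x \<bullet> U x - 2 * (U x \<bullet> V x) + V x \<bullet> V x
      + 2 * (U x \<bullet> (a - b)) - 2 * (V x \<bullet> (a - b)) + (norm (a - b))\<^sup>2 \<partial>M)"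
    by (intro Bochner_Integration.integral_cong refl)
       (simp add: U_V_def power2_norm_eq_inner algebra_simps inner_commute)
  also have "\<dots> = (\<integral>x. U x \<bullet> U x \<partial>M) - 2 * (\<integral>x. U x \<bullet> V x \<partial>M) + (\<integral>x. V x \<bullet> V x \<partial>M)
      + (norm (a - b))\<^sup>2"
    using I by (simp add: UV0 prob_space)
  finally show ?thesis using R by (simp add: FD)
qed

section \<open>Couplings and the comparison of distances\<close>

lemma couplings_measurable:
  assumes "\<gamma> \<in> couplings \<alpha> \<beta>" and "sets \<alpha> = sets borel" "sets \<beta> = sets borel"
  shows "fst \<in> borel_measurable \<gamma>" "snd \<in> borel_measurable \<gamma>"
proof -
  have s: "sets \<gamma> = sets (\<alpha> \<Otimes>\<^sub>M \<beta>)" using assms(1) by (simp add: couplings_def)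
  have "fst \<in> measurable \<gamma> \<alpha>" "snd \<in> measurable \<gamma> \<beta>"
    by (simp_all add: measurable_cong_sets[OF s refl])
  then show "fst \<in> borel_measurable \<gamma>" "snd \<in> borel_measurable \<gamma>"
    by (simp_all add: measurable_cong_sets[OF refl assms(2)] measurable_cong_sets[OF refl assms(3)])
qed

lemma couplings_marginals:
  assumes "\<gamma> \<in> couplings \<alpha> \<beta>" and "sets \<alpha> = sets borel" "sets \<beta> = sets borel"
  shows "\<alpha> = distr \<gamma> borel fst" "\<beta> = distr \<gamma> borel snd"
proof -
  have "distr \<gamma> borel fst = distr \<gamma> \<alpha> fst" "distr \<gamma> borel snd = distr \<gamma> \<beta> snd"
    using assms(2,3) by (auto intro!: distr_cong)
  then show "\<alpha> = distr \<gamma> borel fst" "\<beta> = distr \<gamma> borel snd"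
    using assms(1) by (simp_all add: couplings_def)
qed

text \<open>Every coupling is bounded on its own, so no optimal coupling has to exist. A coupling of
  finite cost carries the second moment of \<beta> over to \<alpha>; hence an infinite
  \<open>FID\<close> meets an infinite transport distance.\<close>

lemma FID_le_W2_sq:
  fixes feat :: "'b::euclidean_space \<Rightarrow> real^'m"
  assumes \<alpha>: "prob_space \<alpha>" "sets \<alpha> = sets borel" and \<beta>: "sets \<beta> = sets borel"
    and mom: "finite_second_moment \<beta>" and L: "L > 0" "L-lipschitz_on UNIV feat"
  shows "FID feat \<alpha> \<beta> / ereal (L\<^sup>2) \<le> 2 * enn2ereal (W2_sq \<alpha> \<beta>)"
proof -
  define D where "D = FD (distr \<alpha> borel feat) (distr \<beta> borel feat)"
  \<comment> \<open>The factor \<open>2\<close> matches the \<open>1/2\<close> in the transport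
    cost. Clipping a negative \<open>D\<close> to zero is harmless, as \<open>ennreal_le_iff\<close>
    asks only the upper value to be nonnegative.\<close>
  define T where "T = (if finite_second_moment \<alpha> then ennreal (D / (2 * L\<^sup>2)) else \<infinity>)"
  have feat_cont: "continuous_on UNIV feat" using L(2) by (rule lipschitz_on_continuous_on)
  then have feat_meas [measurable]: "feat \<in> borel_measurable borel" by (rule borel_measurable_continuous_onI)
  have T_le: "T \<le> transport_cost (\<lambda>x y. ennreal ((norm (x - y))\<^sup>2 / 2)) \<gamma>" if \<gamma>: "\<gamma> \<in> couplings \<alpha> \<beta>" for \<gamma>
  proof -
    note [measurable] = couplings_measurable[OF \<gamma> \<alpha>(2) \<beta>]
    have marg: "\<alpha> = distr \<gamma> borel fst" "\<beta> = distr \<gamma> borel snd"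
      using couplings_marginals[OF \<gamma> \<alpha>(2) \<beta>] by auto
    interpret G: prob_space \<gamma> using \<alpha>(1) marg(1) couplings_measurable(1)[OF \<gamma> \<alpha>(2) \<beta>]
      by (metis prob_space_distrD)
    have mom_\<beta>: "sq_integrable \<gamma> snd"
      using mom marg(2) by (simp add: finite_second_moment_def sq_integrable_iff_nn_integral nn_integral_distr)
    show ?thesis
    proof (cases "(\<integral>\<^sup>+ z. ennreal ((norm (fst z - snd z))\<^sup>2 / 2) \<partial>\<gamma>) = \<infinity>")
      case True
      then show ?thesis by (simp add: transport_cost_def)
    next
      case False
      have "(\<integral>\<^sup>+ z. ennreal ((norm (fst z - snd z))\<^sup>2) \<partial>\<gamma>)
          = 2 * (\<integral>\<^sup>+ z. ennreal ((norm (fst z - snd z))\<^sup>2 / 2) \<partial>\<gamma>)"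
        by (subst nn_integral_cmult[symmetric]) (auto simp flip: ennreal_numeral ennreal_mult')
      with False have diff: "sq_integrable \<gamma> (\<lambda>z. fst z - snd z)"
        by (simp add: sq_integrable_iff_nn_integral ennreal_mult_less_top less_top)
      have fst: "sq_integrable \<gamma> fst" using sq_integrable_add[OF diff mom_\<beta>] by simp
      have feat_sq: "sq_integrable \<gamma> (\<lambda>z. feat (h z))" if h: "sq_integrable \<gamma> h" for h
      proof -
        have [measurable]: "h \<in> borel_measurable \<gamma>" using h by (simp add: sq_integrable_def)
        \<comment> \<open>A Lipschitz map grows linearly only after subtracting its value at the
          origin; that constant is square integrable because the coupling is a probability
          measure.\<close>
        have "sq_integrable \<gamma> (\<lambda>z. feat (h z) - feat 0)"
        proof (rule sq_integrable_bound[OF h, where c = L])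
          show "norm (feat (h z) - feat 0) \<le> L * norm (h z)" for z
            using lipschitz_onD[OF L(2), of "h z" 0] by (simp add: dist_norm)
        qed measurable
        from sq_integrable_add[OF this G.sq_integrable_const[of "feat 0"]] show ?thesis by simp
      qed
      have "(\<lambda>z. fst z) = fst" "(\<lambda>z. snd z) = snd" by auto
      have "D = FD (distr \<gamma> borel (\<lambda>z. feat (fst z))) (distr \<gamma> borel (\<lambda>z. feat (snd z)))"
        unfolding D_def by (subst marg(1), subst marg(2)) (simp add: distr_distr comp_def)
      also have "\<dots> \<le> (\<integral>z. (norm (feat (fst z) - feat (snd z)))\<^sup>2 \<partial>\<gamma>)"
        by (intro G.FD_le feat_sq fst mom_\<beta>)
      also have "\<dots> \<le> (\<integral>z. L\<^sup>2 * (norm (fst z - snd z))\<^sup>2 \<partial>\<gamma>)"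
      proof (rule integral_mono)
        show "integrable \<gamma> (\<lambda>z. (norm (feat (fst z) - feat (snd z)))\<^sup>2)"
          using sq_integrable_diff[OF feat_sq[OF fst] feat_sq[OF mom_\<beta>]] by (simp add: sq_integrable_def)
        show "integrable \<gamma> (\<lambda>z. L\<^sup>2 * (norm (fst z - snd z))\<^sup>2)"
          using diff by (simp add: sq_integrable_def)
        show "(norm (feat (fst z) - feat (snd z)))\<^sup>2 \<le> L\<^sup>2 * (norm (fst z - snd z))\<^sup>2" for z
          using power_mono[OF lipschitz_onD[OF L(2), of "fst z" "snd z"], of 2]
          by (simp add: dist_norm power_mult_distrib)
      qed
      finally have "D / (2 * L\<^sup>2) \<le> (\<integral>z. (norm (fst z - snd z))\<^sup>2 / 2 \<partial>\<gamma>)"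
        using L(1) by (simp add: field_simps)
      moreover have "integrable \<gamma> (\<lambda>z. (norm (fst z - snd z))\<^sup>2 / 2)"
        using diff by (simp add: sq_integrable_def)
      moreover have "finite_second_moment \<alpha>"
        using fst unfolding finite_second_moment_def
        by (subst marg(1)) (simp add: nn_integral_distr sq_integrable_iff_nn_integral)
      ultimately show ?thesis
        by (simp add: T_def transport_cost_def nn_integral_eq_integral ennreal_leI)
    qed
  qed
  then have T: "T \<le> W2_sq \<alpha> \<beta>" unfolding W2_sq_def by (rule INF_greatest)
  show ?thesis
  proof (cases "W2_sq \<alpha> \<beta>")
    case (real w)
    with T have fin: "finite_second_moment \<alpha>" by (auto simp: T_def top_unique split: if_splits)
    then have "ennreal (D / (2 * L\<^sup>2)) \<le> ennreal w" using T real by (simp add: T_def)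
    then have "D / (2 * L\<^sup>2) \<le> w" using real(1) by (simp add: ennreal_le_iff)
    then have "ereal (D / L\<^sup>2) \<le> ereal (2 * w)" using L(1) by (simp add: field_simps)
    then show ?thesis using real fin mom L(1) by (simp add: FID_def D_def enn2ereal_ennreal)
  next
    case top
    then show ?thesis by (simp add: top_ereal_def)
  qed
qed

lemma W2_sq_distr_le:
  fixes S T :: "'a \<Rightarrow> 'b::euclidean_space"
  assumes [measurable]: "S \<in> borel_measurable \<mu>" "T \<in> borel_measurable \<mu>"
    and \<nu>: "sets \<nu> = sets borel" "\<nu> = distr \<mu> borel T"
  shows "2 * enn2ereal (W2_sq (distr \<mu> borel S) \<nu>)
    \<le> enn2ereal (\<integral>\<^sup>+ x. ennreal ((norm (S x - T x))\<^sup>2) \<partial>\<mu>)"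
proof -
  define \<gamma> where "\<gamma> = distr \<mu> (borel \<Otimes>\<^sub>M borel) (\<lambda>x. (S x, T x))"
  have "\<gamma> \<in> couplings (distr \<mu> borel S) \<nu>"
    unfolding couplings_def \<nu>(2) \<gamma>_def
    by (auto simp: distr_distr comp_def cong: distr_cong intro!: sets_pair_measure_cong)
  then have "W2_sq (distr \<mu> borel S) \<nu> \<le> transport_cost (\<lambda>x y. ennreal ((norm (x - y))\<^sup>2 / 2)) \<gamma>"
    unfolding W2_sq_def by (rule INF_lower)
  also have "\<dots> = (\<integral>\<^sup>+ x. ennreal ((norm (S x - T x))\<^sup>2 / 2) \<partial>\<mu>)"
    unfolding transport_cost_def \<gamma>_def by (subst nn_integral_distr) auto
  finally have "2 * W2_sq (distr \<mu> borel S) \<nu> \<le> 2 * (\<integral>\<^sup>+ x. ennreal ((norm (S x - T x))\<^sup>2 / 2) \<partial>\<mu>)"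
    by (rule mult_left_mono) simp
  also have "\<dots> = (\<integral>\<^sup>+ x. ennreal ((norm (S x - T x))\<^sup>2) \<partial>\<mu>)"
    by (subst nn_integral_cmult[symmetric]) (auto simp flip: ennreal_numeral ennreal_mult')
  finally show ?thesis by (simp add: less_eq_ennreal.rep_eq times_ennreal.rep_eq)
qed

section \<open>Cyclical monotonicity of optimal maps\<close>

text \<open>Meaningful when both measures have the same measurable sets. The competitor plan is the
  sum of an untouched part and a rerouted part.\<close>

definition add_measure :: "'a measure \<Rightarrow> 'a measure \<Rightarrow> 'a measure" where
  "add_measure M N = measure_of (space M) (sets M) (\<lambda>A. emeasure M A + emeasure N A)"

lemma sets_add_measure [simp, measurable_cong]: "sets (add_measure M N) = sets M"
  by (simp add: add_measure_def sets.sigma_sets_eq)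

lemma space_add_measure [simp]: "space (add_measure M N) = space M"
  by (simp add: add_measure_def)

lemma emeasure_add_measure:
  assumes "sets N = sets M" "A \<in> sets M"
  shows "emeasure (add_measure M N) A = emeasure M A + emeasure N A"
proof (rule emeasure_measure_of[OF add_measure_def])
  show "sets M \<subseteq> Pow (space M)" by (rule sets.space_closed)
  show "A \<in> sets (add_measure M N)" using assms by simp
  show "positive (sets (add_measure M N)) (\<lambda>A. emeasure M A + emeasure N A)"
    by (simp add: positive_def)
  show "countably_additive (sets (add_measure M N)) (\<lambda>A. emeasure M A + emeasure N A)"
  proof (rule countably_additiveI)
    fix F :: "nat \<Rightarrow> _" assume "range F \<subseteq> sets (add_measure M N)" "disjoint_family F"
    then show "(\<Sum>i. emeasure M (F i) + emeasure N (F i)) = emeasure M (\<Union> (range F)) + emeasure N (\<Union> (range F))"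
      using assms(1) suminf_emeasure[of F M] suminf_emeasure[of F N]
      by (simp add: suminf_add[symmetric])
  qed
qed

lemma nn_integral_add_measure:
  assumes "f \<in> borel_measurable M" and sets: "sets N = sets M"
  shows "(\<integral>\<^sup>+ x. f x \<partial>add_measure M N) = (\<integral>\<^sup>+ x. f x \<partial>M) + (\<integral>\<^sup>+ x. f x \<partial>N)"
  using assms(1)
proof induction
  case (cong f g)
  then show ?case
    using sets_eq_imp_space_eq[OF sets] by (simp cong: nn_integral_cong_simp)
next
  case (set A)
  then show ?case using sets by (simp add: emeasure_add_measure)
next
  case (mult u c)
  have [measurable]: "u \<in> borel_measurable (add_measure M N)" "u \<in> borel_measurable N" "u \<in> borel_measurable M"
    using mult(2) by (simp_all add: measurable_cong_sets[OF sets refl] measurable_cong_sets[OF sets_add_measure refl])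
  then show ?case using mult by (simp add: nn_integral_cmult distrib_left)
next
  case (add u v)
  have [measurable]: "u \<in> borel_measurable (add_measure M N)" "u \<in> borel_measurable N" "u \<in> borel_measurable M"
    "v \<in> borel_measurable (add_measure M N)" "v \<in> borel_measurable N" "v \<in> borel_measurable M"
    using add by (simp_all add: measurable_cong_sets[OF sets refl] measurable_cong_sets[OF sets_add_measure refl])
  then show ?case using add by (simp add: nn_integral_add ac_simps)
next
  case (seq U)
  have [measurable]: "U i \<in> borel_measurable (add_measure M N)" "U i \<in> borel_measurable N" "U i \<in> borel_measurable M" for i
    using seq by (simp_all add: measurable_cong_sets[OF sets refl] measurable_cong_sets[OF sets_add_measure refl])
  have inc: "incseq (\<lambda>i. \<integral>\<^sup>+ x. U i x \<partial>M)" "incseq (\<lambda>i. \<integral>\<^sup>+ x. U i x \<partial>N)"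
    using seq(3) by (auto simp: mono_def le_fun_def intro!: nn_integral_mono)
  have f: "Sup (range U) = (\<lambda>x. SUP i. U i x)" by (auto simp: fun_eq_iff image_comp)
  show ?case
    unfolding f using seq by (simp add: nn_integral_monotone_convergence_SUP ennreal_SUP_add[OF inc])
qed

lemma sum_lessThan_Suc_cyclic:
  fixes f :: "nat \<Rightarrow> 'a::comm_monoid_add"
  assumes "f n = f 0" shows "(\<Sum>i<n. f (Suc i)) = (\<Sum>i<n. f i)"
proof (cases n)
  case (Suc m)
  have "(\<Sum>i<Suc m. f (Suc i)) = (\<Sum>i<m. f (Suc i)) + f 0" using assms Suc by simp
  also have "\<dots> = (\<Sum>i<Suc m. f i)" by (simp add: sum.lessThan_Suc_shift add.commute del: sum.lessThan_Suc)
  finally show ?thesis using Suc by simp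
qed simp

text \<open>Competitor plan: remove the mass \<open>k\<close> from the graph of \<open>T\<close> above every \<open>A i\<close>, and send
  the mass removed above \<open>A (i + 1)\<close> to the image of \<open>A i\<close> by a product measure.\<close>

lemma optimal_map_exchange:
  fixes Q T :: "'a \<Rightarrow> 'b::euclidean_space"
  assumes \<mu>: "prob_space \<mu>" and [measurable]: "Q \<in> borel_measurable \<mu>" "T \<in> borel_measurable \<mu>"
    and \<nu>: "sets \<nu> = sets borel" "distr \<mu> \<nu> T = \<nu>"
    and opt: "optimal_plan (embedded_cost Q) \<mu> \<nu> (distr \<mu> (\<mu> \<Otimes>\<^sub>M \<nu>) (\<lambda>x. (x, T x)))"
    and fin: "(\<integral>\<^sup>+ x. embedded_cost Q x (T x) \<partial>\<mu>) < \<infinity>"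
    and n: "n > 0" and A[measurable]: "\<And>i. A i \<in> sets \<mu>" and pos: "\<And>i. 0 < measure \<mu> (A i)" and cyc: "A n = A 0"
    and u: "\<And>i x. i < n \<Longrightarrow> x \<in> A i \<Longrightarrow> ennreal (u i) \<le> embedded_cost Q x (T x)"
    and v: "\<And>i x x'. i < n \<Longrightarrow> x \<in> A (Suc i) \<Longrightarrow> x' \<in> A i \<Longrightarrow> embedded_cost Q x (T x') \<le> ennreal (v i)"
  shows "(\<Sum>i<n. ennreal (u i)) \<le> (\<Sum>i<n. ennreal (v i))"
proof -
  interpret prob_space \<mu> by fact
  note fubini_fst = nn_integral_fst
  interpret pair_sigma_finite \<mu> \<mu> ..
  have T\<nu>[measurable]: "T \<in> measurable \<mu> \<nu>" by (simp add: measurable_cong_sets[OF refl \<nu>(1)])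
  have cost_meas[measurable]: "(\<lambda>z. embedded_cost Q (fst z) (snd z)) \<in> borel_measurable (\<mu> \<Otimes>\<^sub>M \<nu>)"
  proof -
    have [measurable]: "snd \<in> borel_measurable (\<mu> \<Otimes>\<^sub>M \<nu>)"
      using measurable_snd[of \<mu> \<nu>] by (simp add: measurable_cong_sets[OF refl \<nu>(1)])
    show ?thesis unfolding embedded_cost_def by measurable
  qed
  define p where "p i = measure \<mu> (A i)" for i
  have p: "0 < p i" "emeasure \<mu> (A i) = ennreal (p i)" for i
    using pos by (simp_all add: p_def emeasure_eq_measure)
  \<comment> \<open>The sets \<open>A i\<close> may overlap, so up to \<open>n\<close> removals hit
    the same point. Taking \<open>k\<close> as the smallest mass divided by \<open>n\<close> keeps
    the total removed density \<open>s\<close> at most \<open>1\<close>.\<close>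
  define k where "k = Min (p ` {..<n}) / n"
  have "0 < Min (p ` {..<n})" using n p(1) by (subst Min_gr_iff) auto
  then have k: "0 < k" using n by (simp add: k_def)
  have kp: "k / p i \<le> 1 / n" if "i < n" for i
  proof -
    have "Min (p ` {..<n}) \<le> p i" using that by simp
    then show ?thesis using p(1)[of i] n by (simp add: k_def field_simps)
  qed
  define s where "s x = (\<Sum>i<n. ennreal (k / p i) * indicator (A i) x)" for x
  define r where "r x = 1 - s x" for x
  \<comment> \<open>With this weight the product of \<open>A (Suc i)\<close> and \<open>A i\<close>
    receives total mass \<open>k\<close>.\<close>
  define b where "b i = ennreal (k / (p (Suc i) * p i))" for i
  define w where "w z = (\<Sum>i<n. b i * indicator (A (Suc i)) (fst z) * indicator (A i) (snd z))" for z
  have [measurable]: "s \<in> borel_measurable \<mu>" "r \<in> borel_measurable \<mu>" "w \<in> borel_measurable (\<mu> \<Otimes>\<^sub>M \<mu>)"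
    unfolding s_def[abs_def] r_def[abs_def] w_def[abs_def] by measurable
  have [measurable]: "(\<lambda>x'. w (x, x')) \<in> borel_measurable \<mu>" "(\<lambda>x'. w (x', x)) \<in> borel_measurable \<mu>" for x
    unfolding w_def fst_conv snd_conv by measurable
  have "s x \<le> 1" for x
  proof -
    have "s x \<le> (\<Sum>i<n. ennreal (1 / n))"
      unfolding s_def using kp by (intro sum_mono) (auto simp: indicator_def intro: ennreal_leI)
    also have "\<dots> = 1" using n by (simp add: ennreal_of_nat_eq_real_of_nat flip: ennreal_mult)
    finally show ?thesis .
  qed
  then have rs: "r x + s x = 1" for x by (simp add: r_def diff_add_cancel_ennreal)
  \<comment> \<open>Closing the cycle lets the index shift be absorbed: the first marginal of the
    rerouted mass, indexed by \<open>Suc i\<close>, equals the removed mass, indexed by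
    \<open>i\<close>.\<close>
  have s_shift: "(\<Sum>i<n. ennreal (k / p (Suc i)) * indicator (A (Suc i)) x) = s x" for x
    unfolding s_def using cyc by (intro sum_lessThan_Suc_cyclic) (simp add: p_def)
  have bp: "b i * ennreal (p i) = ennreal (k / p (Suc i))" "b i * ennreal (p (Suc i)) = ennreal (k / p i)" for i
    using p(1)[of i] p(1)[of "Suc i"] k by (simp_all add: b_def flip: ennreal_mult)
  have w_snd: "(\<integral>\<^sup>+ x'. w (x, x') \<partial>\<mu>) = s x" for x
  proof -
    have "(\<integral>\<^sup>+ x'. w (x, x') \<partial>\<mu>)
        = (\<Sum>i<n. \<integral>\<^sup>+ x'. b i * indicator (A (Suc i)) x * indicator (A i) x' \<partial>\<mu>)"
      unfolding w_def fst_conv snd_conv by (rule nn_integral_sum) measurable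
    also have "\<dots> = (\<Sum>i<n. ennreal (k / p (Suc i)) * indicator (A (Suc i)) x)"
      by (rule sum.cong[OF refl]) (simp only: nn_integral_cmult_indicator[OF A] p(2) bp(1)[symmetric], simp only: mult_ac)
    finally show ?thesis by (simp only: s_shift)
  qed
  have w_fst: "(\<integral>\<^sup>+ x. w (x, x') \<partial>\<mu>) = s x'" for x'
  proof -
    have "(\<integral>\<^sup>+ x. w (x, x') \<partial>\<mu>)
        = (\<Sum>i<n. \<integral>\<^sup>+ x. b i * indicator (A (Suc i)) x * indicator (A i) x' \<partial>\<mu>)"
      unfolding w_def fst_conv snd_conv by (rule nn_integral_sum) measurable
    also have "\<dots> = s x'"
      unfolding s_def
    proof (rule sum.cong[OF refl])
      fix i
      have "(\<integral>\<^sup>+ x. b i * indicator (A (Suc i)) x * indicator (A i) x' \<partial>\<mu>)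
          = (\<integral>\<^sup>+ x. b i * indicator (A (Suc i)) x \<partial>\<mu>) * indicator (A i) x'"
        by (rule nn_integral_multc) measurable
      then show "(\<integral>\<^sup>+ x. b i * indicator (A (Suc i)) x * indicator (A i) x' \<partial>\<mu>)
          = ennreal (k / p i) * indicator (A i) x'"
        by (simp only: nn_integral_cmult_indicator[OF A] p(2) bp(2))
    qed
    finally show ?thesis .
  qed
  define M1 where "M1 = distr (density \<mu> r) (\<mu> \<Otimes>\<^sub>M \<nu>) (\<lambda>x. (x, T x))"
  define M2 where "M2 = distr (density (\<mu> \<Otimes>\<^sub>M \<mu>) w) (\<mu> \<Otimes>\<^sub>M \<nu>) (\<lambda>z. (fst z, T (snd z)))"
  define \<pi>' where "\<pi>' = add_measure M1 M2"
  have sets_\<pi>'[measurable_cong]: "sets \<pi>' = sets (\<mu> \<Otimes>\<^sub>M \<nu>)" by (simp add: \<pi>'_def M1_def)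
  have int: "(\<integral>\<^sup>+ z. h z \<partial>\<pi>') = (\<integral>\<^sup>+ x. r x * h (x, T x) \<partial>\<mu>) + (\<integral>\<^sup>+ z. w z * h (fst z, T (snd z)) \<partial>(\<mu> \<Otimes>\<^sub>M \<mu>))"
    if [measurable]: "h \<in> borel_measurable (\<mu> \<Otimes>\<^sub>M \<nu>)" for h
    unfolding \<pi>'_def by (subst nn_integral_add_measure) (simp_all add: M1_def M2_def nn_integral_distr nn_integral_density)
  have "\<pi>' \<in> couplings \<mu> \<nu>"
    unfolding couplings_def
  proof (intro CollectI conjI sets_\<pi>')
    show "distr \<pi>' \<mu> fst = \<mu>"
    proof (rule measure_eqI)
      fix B assume "B \<in> sets (distr \<pi>' \<mu> fst)"
      then have B[measurable]: "B \<in> sets \<mu>" by simp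
      have fubini: "(\<integral>\<^sup>+ z. w z * indicator B (fst z) \<partial>(\<mu> \<Otimes>\<^sub>M \<mu>))
          = (\<integral>\<^sup>+ x. \<integral>\<^sup>+ x'. w (x, x') * indicator B x \<partial>\<mu> \<partial>\<mu>)"
        using fubini_fst[of "\<lambda>z. w z * indicator B (fst z)" \<mu>] by simp
      have "emeasure (distr \<pi>' \<mu> fst) B = (\<integral>\<^sup>+ z. indicator B (fst z) \<partial>\<pi>')"
        by (simp add: nn_integral_distr del: nn_integral_indicator flip: nn_integral_indicator)
      also have "\<dots> = (\<integral>\<^sup>+ x. r x * indicator B x \<partial>\<mu>) + (\<integral>\<^sup>+ x. \<integral>\<^sup>+ x'. w (x, x') * indicator B x \<partial>\<mu> \<partial>\<mu>)"
        by (subst int) (simp_all add: fubini)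
      also have "\<dots> = (\<integral>\<^sup>+ x. r x * indicator B x + s x * indicator B x \<partial>\<mu>)"
        by (simp add: nn_integral_multc w_snd nn_integral_add)
      also have "\<dots> = emeasure \<mu> B" by (simp add: distrib_right[symmetric] rs)
      finally show "emeasure (distr \<pi>' \<mu> fst) B = emeasure \<mu> B" .
    qed simp
    show "distr \<pi>' \<nu> snd = \<nu>"
    proof (rule measure_eqI)
      fix B assume "B \<in> sets (distr \<pi>' \<nu> snd)"
      then have B[measurable]: "B \<in> sets \<nu>" by simp
      have fubini: "(\<integral>\<^sup>+ z. w z * indicator B (T (snd z)) \<partial>(\<mu> \<Otimes>\<^sub>M \<mu>))
          = (\<integral>\<^sup>+ x'. \<integral>\<^sup>+ x. w (x, x') * indicator B (T x') \<partial>\<mu> \<partial>\<mu>)"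
        by (subst nn_integral_snd[symmetric]) simp_all
      have "emeasure (distr \<pi>' \<nu> snd) B = (\<integral>\<^sup>+ z. indicator B (snd z) \<partial>\<pi>')"
        by (simp add: nn_integral_distr del: nn_integral_indicator flip: nn_integral_indicator)
      also have "\<dots> = (\<integral>\<^sup>+ x. r x * indicator B (T x) \<partial>\<mu>) + (\<integral>\<^sup>+ x'. \<integral>\<^sup>+ x. w (x, x') * indicator B (T x') \<partial>\<mu> \<partial>\<mu>)"
        by (subst int) (simp_all add: fubini)
      also have "\<dots> = (\<integral>\<^sup>+ x. r x * indicator B (T x) + s x * indicator B (T x) \<partial>\<mu>)"
        by (simp add: nn_integral_multc w_fst nn_integral_add)
      also have "\<dots> = (\<integral>\<^sup>+ x. indicator B (T x) \<partial>\<mu>)" by (simp add: distrib_right[symmetric] rs)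
      also have "\<dots> = emeasure (distr \<mu> \<nu> T) B"
        by (simp add: nn_integral_distr del: nn_integral_indicator flip: nn_integral_indicator)
      finally show "emeasure (distr \<pi>' \<nu> snd) B = emeasure \<nu> B" by (simp add: \<nu>(2))
    qed simp
  qed
  define c where "c x = embedded_cost Q x (T x)" for x
  have c[measurable]: "c \<in> borel_measurable \<mu>" unfolding c_def[abs_def] embedded_cost_def by measurable
  have "transport_cost (embedded_cost Q) (distr \<mu> (\<mu> \<Otimes>\<^sub>M \<nu>) (\<lambda>x. (x, T x))) \<le> transport_cost (embedded_cost Q) \<pi>'"
    using opt \<open>\<pi>' \<in> couplings \<mu> \<nu>\<close> unfolding optimal_plan_def by blast
  then have "(\<integral>\<^sup>+ x. c x \<partial>\<mu>) \<le> (\<integral>\<^sup>+ x. r x * c x \<partial>\<mu>)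
      + (\<integral>\<^sup>+ z. w z * embedded_cost Q (fst z) (T (snd z)) \<partial>(\<mu> \<Otimes>\<^sub>M \<mu>))"
    by (simp add: transport_cost_def int nn_integral_distr c_def)
  also have "(\<integral>\<^sup>+ x. c x \<partial>\<mu>) = (\<integral>\<^sup>+ x. r x * c x \<partial>\<mu>) + (\<integral>\<^sup>+ x. s x * c x \<partial>\<mu>)"
    by (subst nn_integral_add[symmetric]) (simp_all add: rs flip: distrib_right)
  finally have "(\<integral>\<^sup>+ x. r x * c x \<partial>\<mu>) + (\<integral>\<^sup>+ x. s x * c x \<partial>\<mu>) \<le> (\<integral>\<^sup>+ x. r x * c x \<partial>\<mu>)
      + (\<integral>\<^sup>+ z. w z * embedded_cost Q (fst z) (T (snd z)) \<partial>(\<mu> \<Otimes>\<^sub>M \<mu>))" .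
  \<comment> \<open>The cost of the untouched part occurs on both sides and may be cancelled in
    \<open>ennreal\<close> only because it is finite.\<close>
  moreover have "(\<integral>\<^sup>+ x. r x * c x \<partial>\<mu>) < \<infinity>"
  proof -
    have "r x * c x \<le> c x" for x
      using mult_right_mono[of "r x" 1 "c x"] by (simp add: r_def)
    then have "(\<integral>\<^sup>+ x. r x * c x \<partial>\<mu>) \<le> (\<integral>\<^sup>+ x. c x \<partial>\<mu>)" by (rule nn_integral_mono)
    then show ?thesis using fin by (simp add: c_def[abs_def] less_top top_unique)
  qed
  ultimately have "(\<integral>\<^sup>+ x. s x * c x \<partial>\<mu>) \<le> (\<integral>\<^sup>+ z. w z * embedded_cost Q (fst z) (T (snd z)) \<partial>(\<mu> \<Otimes>\<^sub>M \<mu>))"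
    by (auto simp: ennreal_add_left_cancel_le)
  moreover have "(\<Sum>i<n. ennreal k * ennreal (u i)) \<le> (\<integral>\<^sup>+ x. s x * c x \<partial>\<mu>)"
  proof -
    have "(\<Sum>i<n. ennreal k * ennreal (u i)) = (\<Sum>i<n. \<integral>\<^sup>+ x. (ennreal (k / p i) * ennreal (u i)) * indicator (A i) x \<partial>\<mu>)"
    proof (rule sum.cong[OF refl])
      fix i
      have "ennreal (k / p i) * ennreal (p i) = ennreal k" using p(1)[of i] k by (simp flip: ennreal_mult)
      then show "ennreal k * ennreal (u i) = (\<integral>\<^sup>+ x. (ennreal (k / p i) * ennreal (u i)) * indicator (A i) x \<partial>\<mu>)"
        by (simp add: nn_integral_cmult p(2)) (metis mult.assoc mult.commute)
    qed
    also have "\<dots> = (\<integral>\<^sup>+ x. (\<Sum>i<n. (ennreal (k / p i) * ennreal (u i)) * indicator (A i) x) \<partial>\<mu>)"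
      by (rule nn_integral_sum[symmetric]) measurable
    also have "\<dots> \<le> (\<integral>\<^sup>+ x. s x * c x \<partial>\<mu>)"
      unfolding s_def sum_distrib_right c_def
      by (intro nn_integral_mono sum_mono) (auto simp: indicator_def u intro!: mult_left_mono)
    finally show ?thesis .
  qed
  moreover have "(\<integral>\<^sup>+ z. w z * embedded_cost Q (fst z) (T (snd z)) \<partial>(\<mu> \<Otimes>\<^sub>M \<mu>)) \<le> (\<Sum>i<n. ennreal k * ennreal (v i))"
  proof -
    have "(\<integral>\<^sup>+ z. w z * embedded_cost Q (fst z) (T (snd z)) \<partial>(\<mu> \<Otimes>\<^sub>M \<mu>))
      \<le> (\<integral>\<^sup>+ z. (\<Sum>i<n. (b i * ennreal (v i)) * (indicator (A (Suc i)) (fst z) * indicator (A i) (snd z))) \<partial>(\<mu> \<Otimes>\<^sub>M \<mu>))"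
      unfolding w_def sum_distrib_right
      by (intro nn_integral_mono sum_mono) (auto simp: indicator_def v intro!: mult_left_mono)
    also have "\<dots> = (\<Sum>i<n. \<integral>\<^sup>+ x. \<integral>\<^sup>+ x'. (b i * ennreal (v i)) * (indicator (A (Suc i)) x * indicator (A i) x') \<partial>\<mu> \<partial>\<mu>)"
      by (subst nn_integral_sum) (simp_all add: fubini_fst[symmetric])
    also have "\<dots> = (\<Sum>i<n. (b i * ennreal (v i)) * (ennreal (p (Suc i)) * ennreal (p i)))"
      by (simp add: nn_integral_cmult nn_integral_multc p(2))
    also have "\<dots> = (\<Sum>i<n. ennreal k * ennreal (v i))"
    proof (rule sum.cong[OF refl])
      fix i
      have "b i * ennreal (p (Suc i)) * ennreal (p i) = ennreal k"
        using p(1)[of i] k by (simp add: bp flip: ennreal_mult)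
      then show "(b i * ennreal (v i)) * (ennreal (p (Suc i)) * ennreal (p i)) = ennreal k * ennreal (v i)"
        by (metis mult.assoc mult.commute)
    qed
    finally show ?thesis .
  qed
  ultimately have "ennreal k * (\<Sum>i<n. ennreal (u i)) \<le> ennreal k * (\<Sum>i<n. ennreal (v i))"
    by (simp add: sum_distrib_left)
  then show ?thesis using k by (simp add: ennreal_mult_le_mult_iff)
qed

section \<open>Supports and cyclical monotonicity\<close>

text \<open>The points outside the support are covered by open sets with null preimage. By Lindelof
  countably many of these have the same union, so its preimage is null.\<close>

lemma AE_in_support:
  fixes f :: "'a \<Rightarrow> 'b::{second_countable_topology, metric_space}"
  assumes [measurable]: "f \<in> borel_measurable M"
  shows "AE x in M. \<forall>e>0. 0 < emeasure M {y \<in> space M. dist (f y) (f x) < e}"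
proof -
  define \<F> where "\<F> = {U. open U \<and> emeasure M (f -` U \<inter> space M) = 0}"
  have "\<And>S. S \<in> \<F> \<Longrightarrow> open S" by (simp add: \<F>_def)
  from Lindelof[OF this] obtain \<G> where \<G>: "\<G> \<subseteq> \<F>" "countable \<G>" "\<Union>\<G> = \<Union>\<F>" by auto
  have "AE x in M. \<forall>U\<in>\<G>. f x \<notin> U"
  proof (subst AE_ball_countable[OF \<G>(2)], intro ballI)
    fix U assume "U \<in> \<G>"
    then have U: "open U" "emeasure M (f -` U \<inter> space M) = 0" using \<G>(1) by (auto simp: \<F>_def)
    then have [measurable]: "U \<in> sets borel" by simp
    show "AE x in M. f x \<notin> U"
      by (rule AE_I'[of "f -` U \<inter> space M"]) (auto simp: null_sets_def U)
  qed
  then show ?thesis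
  proof eventually_elim
    case (elim x)
    then have notin: "f x \<notin> \<Union>\<F>" using \<G>(3) by blast
    show ?case
    proof (intro allI impI)
      fix e :: real assume "e > 0"
      then have "f x \<in> ball (f x) e" by simp
      then have "ball (f x) e \<notin> \<F>" using notin by blast
      then have "emeasure M (f -` ball (f x) e \<inter> space M) \<noteq> 0" by (simp add: \<F>_def)
      also have "f -` ball (f x) e \<inter> space M = {y \<in> space M. dist (f y) (f x) < e}"
        by (auto simp: dist_commute)
      finally show "0 < emeasure M {y \<in> space M. dist (f y) (f x) < e}" by (simp add: zero_less_iff_neq_zero)
    qed
  qed
qed

text \<open>A pair \<open>(q, y)\<close> is thought of as a subgradient \<open>y\<close> at
  \<open>q\<close>. Cycles are encoded as sequences, of which only the entries up to
  \<open>n\<close> enter the sum.\<close>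

definition cyclically_monotone :: "('b::real_inner \<times> 'b) set \<Rightarrow> bool" where
  "cyclically_monotone \<Gamma> \<longleftrightarrow>
     (\<forall>n z. (\<forall>i. z i \<in> \<Gamma>) \<longrightarrow> z n = z 0 \<longrightarrow>
        (\<Sum>i<n. snd (z i) \<bullet> (fst (z (Suc i)) - fst (z i))) \<le> 0)"

text \<open>Expanding the squares, the norms of the second components agree termwise and those of
  the first components agree after one turn of the cycle; only inner products remain.\<close>

lemma cyclic_sum_half_norm_sq:
  fixes z :: "nat \<Rightarrow> 'b::real_inner \<times> 'b"
  assumes "z n = z 0"
    and "(\<Sum>i<n. (norm (fst (z i) - snd (z i)))\<^sup>2 / 2) \<le> (\<Sum>i<n. (norm (fst (z (Suc i)) - snd (z i)))\<^sup>2 / 2)"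
  shows "(\<Sum>i<n. snd (z i) \<bullet> (fst (z (Suc i)) - fst (z i))) \<le> 0"
proof -
  have "(norm (fst (z (Suc i)) - snd (z i)))\<^sup>2 / 2 = (norm (fst (z i) - snd (z i)))\<^sup>2 / 2
      + ((norm (fst (z (Suc i))))\<^sup>2 / 2 - (norm (fst (z i)))\<^sup>2 / 2)
      - snd (z i) \<bullet> (fst (z (Suc i)) - fst (z i))" for i
    unfolding power2_norm_eq_inner by (simp add: inner_diff inner_commute field_simps)
  then have "(\<Sum>i<n. (norm (fst (z (Suc i)) - snd (z i)))\<^sup>2 / 2) = (\<Sum>i<n. (norm (fst (z i) - snd (z i)))\<^sup>2 / 2)
      + ((\<Sum>i<n. (norm (fst (z (Suc i))))\<^sup>2 / 2) - (\<Sum>i<n. (norm (fst (z i)))\<^sup>2 / 2))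
      - (\<Sum>i<n. snd (z i) \<bullet> (fst (z (Suc i)) - fst (z i)))"
    by (simp only: sum.distrib sum_subtractf)
  moreover have "(\<Sum>i<n. (norm (fst (z (Suc i))))\<^sup>2 / 2) = (\<Sum>i<n. (norm (fst (z i)))\<^sup>2 / 2)"
    by (rule sum_lessThan_Suc_cyclic) (simp add: assms(1))
  ultimately show ?thesis using assms(2) by simp
qed

text \<open>Small balls around points of the support have preimages of positive mass, so the
  exchange lemma applies to them. By continuity the cost is almost constant on such balls, and the
  error vanishes with the radius.\<close>

lemma optimal_map_cyclically_monotone:
  fixes Q T :: "'a \<Rightarrow> 'b::euclidean_space"
  assumes \<mu>: "prob_space \<mu>" and [measurable]: "Q \<in> borel_measurable \<mu>" "T \<in> borel_measurable \<mu>"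
    and \<nu>: "sets \<nu> = sets borel" "distr \<mu> \<nu> T = \<nu>"
    and opt: "optimal_plan (embedded_cost Q) \<mu> \<nu> (distr \<mu> (\<mu> \<Otimes>\<^sub>M \<nu>) (\<lambda>x. (x, T x)))"
    and fin: "(\<integral>\<^sup>+ x. embedded_cost Q x (T x) \<partial>\<mu>) < \<infinity>"
  shows "cyclically_monotone {z. \<forall>e>0. 0 < emeasure \<mu> {x \<in> space \<mu>. dist (Q x, T x) z < e}}"
  unfolding cyclically_monotone_def
proof (intro allI impI cyclic_sum_half_norm_sq)
  fix n and z :: "nat \<Rightarrow> 'b \<times> 'b"
  assume z: "\<forall>i. z i \<in> {z. \<forall>e>0. 0 < emeasure \<mu> {x \<in> space \<mu>. dist (Q x, T x) z < e}}"
    and cyc: "z n = z 0"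
  interpret prob_space \<mu> by fact
  define C :: "'b \<times> 'b \<Rightarrow> real" where "C = (\<lambda>p. (norm (fst p - snd p))\<^sup>2 / 2)"
  have C_cont: "isCont C p" for p
    unfolding C_def by (intro continuous_intros) auto
  have "(\<Sum>i<n. C (z i)) \<le> (\<Sum>i<n. C (fst (z (Suc i)), snd (z i)))"
  proof (cases "n = 0")
    case False
    then have n: "n > 0" by simp
    show ?thesis
    proof (rule field_le_epsilon)
      fix \<epsilon> :: real assume "\<epsilon> > 0"
      \<comment> \<open>Each of the \<open>n\<close> edges loses \<eta> once in the lower and once
        in the upper bound, hence the factor \<open>2 * n\<close>.\<close>
      define \<eta> where "\<eta> = \<epsilon> / (2 * n)"
      have \<eta>: "\<eta> > 0" using n \<open>\<epsilon> > 0\<close> by (simp add: \<eta>_def)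
      \<comment> \<open>The two coordinates are controlled separately because a swapped pair takes
        \<open>Q x\<close> and \<open>T x'\<close> from different points.\<close>
      have near: "\<forall>\<^sub>F e in at_right 0. \<forall>q y. dist q (fst p) < e \<longrightarrow> dist y (snd p) < e \<longrightarrow> \<bar>C (q, y) - C p\<bar> < \<eta>" for p
      proof -
        obtain d where d: "d > 0" "\<And>p'. dist p' p < d \<Longrightarrow> dist (C p') (C p) < \<eta>"
          using C_cont[of p] \<eta> unfolding continuous_at_eps_delta by blast
        have "\<bar>C (q, y) - C p\<bar> < \<eta>" if "e < d / 2" "dist q (fst p) < e" "dist y (snd p) < e" for e q y
        proof -
          have "dist (q, y) p \<le> dist q (fst p) + dist y (snd p)"
            by (simp add: dist_prod_def sqrt_sum_squares_le_sum)
          then show ?thesis using d(2)[of "(q, y)"] that by (simp add: dist_real_def)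
        qed
        then show ?thesis using d(1) unfolding eventually_at_right_field
          by (intro exI[of _ "d / 2"]) auto
      qed
      have "\<forall>\<^sub>F e in at_right 0. e > 0 \<and> (\<forall>i<n. (\<forall>q y. dist q (fst (z i)) < e \<longrightarrow> dist y (snd (z i)) < e \<longrightarrow> \<bar>C (q, y) - C (z i)\<bar> < \<eta>) \<and>
         (\<forall>q y. dist q (fst (z (Suc i))) < e \<longrightarrow> dist y (snd (z i)) < e \<longrightarrow> \<bar>C (q, y) - C (fst (z (Suc i)), snd (z i))\<bar> < \<eta>))"
      proof (intro eventually_conj eventually_ball_finite[of "{..<n}", simplified Ball_def lessThan_iff] eventually_at_right_less allI impI)
        show "\<forall>\<^sub>F e in at_right 0. (\<forall>q y. dist q (fst (z i)) < e \<longrightarrow> dist y (snd (z i)) < e \<longrightarrow> \<bar>C (q, y) - C (z i)\<bar> < \<eta>)" for i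
          using near[of "z i"] .
        show "\<forall>\<^sub>F e in at_right 0. (\<forall>q y. dist q (fst (z (Suc i))) < e \<longrightarrow> dist y (snd (z i)) < e \<longrightarrow> \<bar>C (q, y) - C (fst (z (Suc i)), snd (z i))\<bar> < \<eta>)" for i
          using near[of "(fst (z (Suc i)), snd (z i))"] by simp
      qed simp
      from eventually_happens'[OF trivial_limit_at_right_real this] obtain e where E: "e > 0 \<and> (\<forall>i<n. (\<forall>q y. dist q (fst (z i)) < e \<longrightarrow> dist y (snd (z i)) < e \<longrightarrow> \<bar>C (q, y) - C (z i)\<bar> < \<eta>) \<and>
         (\<forall>q y. dist q (fst (z (Suc i))) < e \<longrightarrow> dist y (snd (z i)) < e \<longrightarrow> \<bar>C (q, y) - C (fst (z (Suc i)), snd (z i))\<bar> < \<eta>))"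
        by blast
      then have e: "e > 0"
        "\<And>i q y. i < n \<Longrightarrow> dist q (fst (z i)) < e \<Longrightarrow> dist y (snd (z i)) < e \<Longrightarrow> \<bar>C (q, y) - C (z i)\<bar> < \<eta>"
        "\<And>i q y. i < n \<Longrightarrow> dist q (fst (z (Suc i))) < e \<Longrightarrow> dist y (snd (z i)) < e
          \<Longrightarrow> \<bar>C (q, y) - C (fst (z (Suc i)), snd (z i))\<bar> < \<eta>"
        by simp_all
      define A where "A i = {x \<in> space \<mu>. dist (Q x, T x) (z i) < e}" for i
      have near_A: "dist (Q x) (fst (z i)) < e" "dist (T x) (snd (z i)) < e" if "x \<in> A i" for i x
        using that dist_fst_le[of "(Q x, T x)" "z i"] dist_snd_le[of "(Q x, T x)" "z i"] by (simp_all add: A_def)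
      have C_nonneg: "0 \<le> C p" for p by (simp add: C_def)
      have cost: "embedded_cost Q x y = ennreal (C (Q x, y))" for x y
        by (simp add: embedded_cost_def C_def)
      have "(\<Sum>i<n. ennreal (C (z i) - \<eta>)) \<le> (\<Sum>i<n. ennreal (C (fst (z (Suc i)), snd (z i)) + \<eta>))"
      proof (rule optimal_map_exchange[OF assms n, of A])
        show "A i \<in> sets \<mu>" for i unfolding A_def by measurable
        show "0 < measure \<mu> (A i)" for i
          using z e(1) by (simp add: A_def emeasure_eq_measure)
        show "A n = A 0" by (simp add: A_def cyc)
        show "ennreal (C (z i) - \<eta>) \<le> embedded_cost Q x (T x)" if "i < n" "x \<in> A i" for i x
          using e(2)[OF that(1) near_A[OF that(2)]] by (auto simp: cost intro!: ennreal_leI)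
        show "embedded_cost Q x (T x') \<le> ennreal (C (fst (z (Suc i)), snd (z i)) + \<eta>)"
          if "i < n" "x \<in> A (Suc i)" "x' \<in> A i" for i x x'
          using e(3)[OF that(1) near_A(1)[OF that(2)] near_A(2)[OF that(3)]] by (auto simp: cost intro!: ennreal_leI)
      qed
      also have "\<dots> = ennreal (\<Sum>i<n. C (fst (z (Suc i)), snd (z i)) + \<eta>)"
        using C_nonneg \<eta> by (intro sum_ennreal) (simp add: add_nonneg_nonneg less_imp_le)
      \<comment> \<open>The lower bounds \<open>C (z i) - \<eta>\<close> can be negative, where
        \<open>ennreal\<close> gives zero; \<open>max 0\<close> records this before the return to
        the reals.\<close>
      finally have "ennreal (\<Sum>i<n. max 0 (C (z i) - \<eta>)) \<le> ennreal (\<Sum>i<n. C (fst (z (Suc i)), snd (z i)) + \<eta>)"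
        by (simp add: ennreal_max_0 flip: sum_ennreal)
      then have "(\<Sum>i<n. max 0 (C (z i) - \<eta>)) \<le> (\<Sum>i<n. C (fst (z (Suc i)), snd (z i)) + \<eta>)"
        using C_nonneg \<eta> by (subst (asm) ennreal_le_iff) (auto intro!: sum_nonneg add_nonneg_nonneg)
      moreover have "(\<Sum>i<n. C (z i) - \<eta>) \<le> (\<Sum>i<n. max 0 (C (z i) - \<eta>))" by (rule sum_mono) simp
      ultimately have "(\<Sum>i<n. C (z i)) \<le> (\<Sum>i<n. C (fst (z (Suc i)), snd (z i))) + 2 * n * \<eta>"
        by (simp add: sum.distrib sum_subtractf)
      then show "(\<Sum>i<n. C (z i)) \<le> (\<Sum>i<n. C (fst (z (Suc i)), snd (z i))) + \<epsilon>"
        using n by (simp add: \<eta>_def)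
    qed
  qed simp
  then show "(\<Sum>i<n. (norm (fst (z i) - snd (z i)))\<^sup>2 / 2) \<le> (\<Sum>i<n. (norm (fst (z (Suc i)) - snd (z i)))\<^sup>2 / 2)"
    by (simp add: C_def)
qed

text \<open>Rockafellar's construction: the supremum over all chains in \<open>\<Gamma>\<close> that start at a fixed point.\<close>

lemma cyclically_monotone_potential:
  fixes \<Gamma> :: "('b::euclidean_space \<times> 'b) set"
  assumes cm: "cyclically_monotone \<Gamma>" and z0: "z0 \<in> \<Gamma>"
  obtains \<phi> :: "'b \<Rightarrow> ereal" where "\<phi> \<in> borel_measurable borel"
    "\<And>q. ereal (snd z0 \<bullet> (q - fst z0)) \<le> \<phi> q"
    "\<And>q y. (q, y) \<in> \<Gamma> \<Longrightarrow> \<phi> q < \<infinity>"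
    "\<And>q y q'. (q, y) \<in> \<Gamma> \<Longrightarrow> \<phi> q + ereal (y \<bullet> (q' - q)) \<le> \<phi> q'"
proof -
  define chains :: "(nat \<times> (nat \<Rightarrow> 'b \<times> 'b)) set" where "chains = {(n, z). z 0 = z0 \<and> (\<forall>i. z i \<in> \<Gamma>)}"
  define val where "val c q = (case c of (n, z) \<Rightarrow>
    (\<Sum>i<n. snd (z i) \<bullet> (fst (z (Suc i)) - fst (z i))) + snd (z n) \<bullet> (q - fst (z n)))"
    for c :: "nat \<times> (nat \<Rightarrow> 'b \<times> 'b)" and q
  define \<phi> where "\<phi> q = (SUP c\<in>chains. ereal (val c q))" for q
  \<comment> \<open>The chain is prolonged by \<open>p\<close> at position \<open>Suc n\<close> and
    returns to \<open>z0\<close> from then on, so that it closes to a cycle at index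
    \<open>Suc (Suc n)\<close>.\<close>
  define ext where "ext n z p = (\<lambda>i. if i \<le> n then z i else if i = Suc n then p else z0)"
    for n :: nat and z :: "nat \<Rightarrow> 'b \<times> 'b" and p
  have ext_chain: "(Suc n, ext n z p) \<in> chains" if "(n, z) \<in> chains" "p \<in> \<Gamma>" for n z p
    using that z0 by (auto simp: chains_def ext_def)
  have ext_sum: "(\<Sum>i<Suc n. snd (ext n z p i) \<bullet> (fst (ext n z p (Suc i)) - fst (ext n z p i))) = val (n, z) (fst p)" for n z p
  proof -
    have "(\<Sum>i<n. snd (ext n z p i) \<bullet> (fst (ext n z p (Suc i)) - fst (ext n z p i)))
        = (\<Sum>i<n. snd (z i) \<bullet> (fst (z (Suc i)) - fst (z i)))"
      by (rule sum.cong[OF refl]) (simp add: ext_def)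
    then show ?thesis by (simp add: val_def ext_def)
  qed
  have base: "(0, \<lambda>_. z0) \<in> chains" using z0 by (simp add: chains_def)
  show ?thesis
  proof
    show "\<phi> \<in> borel_measurable borel"
    proof (subst borel_measurable_ereal_iff_Ioi, intro allI)
      fix a :: ereal
      \<comment> \<open>A supremum of continuous functions has open strict superlevel sets, however
        many chains there are; this yields measurability.\<close>
      have "\<phi> -` {a<..} \<inter> space borel = (\<Union>c\<in>chains. {q. a < ereal (val c q)})"
        by (auto simp: \<phi>_def less_SUP_iff)
      also have "open \<dots>"
        unfolding val_def by (intro open_UN ballI open_Collect_less) (auto intro!: continuous_intros split: prod.split)
      finally show "\<phi> -` {a<..} \<inter> space borel \<in> sets borel" by simp
    qed
    show "ereal (snd z0 \<bullet> (q - fst z0)) \<le> \<phi> q" for q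
      unfolding \<phi>_def by (rule SUP_upper2[OF base]) (simp add: val_def)
    show "\<phi> q < \<infinity>" if qy: "(q, y) \<in> \<Gamma>" for q y
    proof -
      \<comment> \<open>Closing any chain through \<open>(q, y)\<close> back to \<open>z0\<close>
        and applying cyclical monotonicity bounds its value independently of the chain.\<close>
      have "\<phi> q \<le> ereal (y \<bullet> (q - fst z0))"
        unfolding \<phi>_def
      proof (intro SUP_least, clarify)
        fix n z assume c: "(n, z) \<in> chains"
        let ?z = "ext n z (q, y)"
        have "(\<Sum>i<Suc (Suc n). snd (?z i) \<bullet> (fst (?z (Suc i)) - fst (?z i))) \<le> 0"
          using cm[unfolded cyclically_monotone_def, rule_format, of ?z "Suc (Suc n)"] c qy z0
          by (auto simp: ext_def chains_def)
        then have "val (n, z) q + y \<bullet> (fst z0 - q) \<le> 0"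
          by (subst (asm) sum.lessThan_Suc, subst (asm) ext_sum) (simp add: ext_def)
        then show "ereal (val (n, z) q) \<le> ereal (y \<bullet> (q - fst z0))" by (simp add: inner_diff_right)
      qed
      then show ?thesis by auto
    qed
    show "\<phi> q + ereal (y \<bullet> (q' - q)) \<le> \<phi> q'" if qy: "(q, y) \<in> \<Gamma>" for q y q'
    proof -
      have "ereal (val c q) \<le> \<phi> q' - ereal (y \<bullet> (q' - q))" if "c \<in> chains" for c
      proof -
        obtain n z where c: "c = (n, z)" by force
        \<comment> \<open>Appending \<open>(q, y)\<close> to a chain is again a chain, whose value
          at \<open>q'\<close> has gained exactly the subgradient term.\<close>
        have "val c q + y \<bullet> (q' - q) = val (Suc n, ext n z (q, y)) q'"
          by (simp only: c val_def[of "(Suc n, _)"] prod.case ext_sum) (simp add: ext_def)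
        also have "ereal \<dots> \<le> \<phi> q'"
          unfolding \<phi>_def using that qy c by (intro SUP_upper ext_chain) auto
        finally show ?thesis by (simp add: ereal_le_minus)
      qed
      then have "\<phi> q \<le> \<phi> q' - ereal (y \<bullet> (q' - q))" unfolding \<phi>_def[of q] by (rule SUP_least)
      then show ?thesis by (simp add: ereal_le_minus)
    qed
  qed
qed

section \<open>Strongly convex functions\<close>

text \<open>Beyond the unit ball, \<open>y / norm y\<close> is a convex combination of
  \<open>0\<close> and \<open>y\<close>, so bounds on the ball propagate along rays at a linear
  rate. The quadratic term of a strongly convex function then dominates.\<close>

lemma convex_linear_lower_bound:
  fixes h :: "'b::euclidean_space \<Rightarrow> real"
  assumes "convex_on UNIV h"
  obtains K where "0 \<le> K" "\<And>y. norm y \<le> 1 \<Longrightarrow> h y \<le> K" "\<And>y. - K - 2 * K * norm y \<le> h y"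
proof -
  have "continuous_on (cball 0 1) h"
    using convex_on_continuous[OF open_UNIV assms] continuous_on_subset by blast
  then have "bounded (h ` cball 0 1)"
    by (intro compact_imp_bounded compact_continuous_image) auto
  then obtain K where "\<forall>y\<in>cball 0 1. \<bar>h y\<bar> \<le> K"
    unfolding bounded_iff by auto
  then have K: "\<bar>h y\<bar> \<le> K" if "norm y \<le> 1" for y using that by simp
  have "0 \<le> K" using K[of 0] by simp
  have "- K - 2 * K * norm y \<le> h y" for y
  proof (cases "norm y \<le> 1")
    case True
    then show ?thesis using K[of y] \<open>0 \<le> K\<close> by (simp add: abs_le_iff) (smt (verit) mult_nonneg_nonneg norm_ge_zero)
  next
    case False
    define s where "s = norm y"
    have s: "s > 1" using False by (simp add: s_def)
    have "h ((1 - 1 / s) *\<^sub>R 0 + (1 / s) *\<^sub>R y) \<le> (1 - 1 / s) * h 0 + (1 / s) * h y"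
      using s by (intro convex_onD[OF assms]) auto
    then have "s * h ((1 / s) *\<^sub>R y) \<le> (s - 1) * h 0 + h y"
      using s by (simp add: field_simps)
    moreover have "norm ((1 / s) *\<^sub>R y) \<le> 1" by (simp add: s_def)
    then have "- K \<le> h ((1 / s) *\<^sub>R y)" using K[of "(1 / s) *\<^sub>R y"] by linarith
    then have "s * (- K) \<le> s * h ((1 / s) *\<^sub>R y)" using s by (intro mult_left_mono) auto
    moreover have "(s - 1) * h 0 \<le> (s - 1) * K" using K[of 0] s by (intro mult_left_mono) auto
    ultimately have "s * (- K) - (s - 1) * K \<le> h y" by linarith
    then show ?thesis using \<open>0 \<le> K\<close> by (simp add: algebra_simps s_def)
  qed
  moreover have "h y \<le> K" if "norm y \<le> 1" for y using K[OF that] by simp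
  ultimately show ?thesis using that \<open>0 \<le> K\<close> by blast
qed

text \<open>Coercivity gives a minimiser \<open>m\<close>. Quadratic growth follows by comparing
  \<open>m\<close> with points on the segment to \<open>y\<close>, where strong convexity gains a
  term proportional to the squared length.\<close>

lemma strongly_convex_minimizer:
  fixes \<psi> :: "'b::euclidean_space \<Rightarrow> real"
  assumes \<beta>: "\<beta> > 0" and sc: "strongly_convex \<beta> \<psi>"
  obtains m where "\<And>y. \<psi> m - q \<bullet> m + \<beta> / 2 * (norm (y - m))\<^sup>2 \<le> \<psi> y - q \<bullet> y"
proof -
  define h where "h y = \<psi> y - \<beta> / 2 * (norm y)\<^sup>2" for y
  define F where "F y = \<psi> y - q \<bullet> y" for y
  have h: "convex_on UNIV h" using sc by (simp add: strongly_convex_def h_def[abs_def])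
  have F_eq: "F y = h y + \<beta> / 2 * (norm y)\<^sup>2 - q \<bullet> y" for y by (simp add: F_def h_def)
  have F_cont: "continuous_on A F" for A
    unfolding F_eq[abs_def] using convex_on_continuous[OF open_UNIV h] continuous_on_subset
    by (intro continuous_intros) blast
  obtain K where K: "0 \<le> K" "\<And>y. norm y \<le> 1 \<Longrightarrow> h y \<le> K" "\<And>y. - K - 2 * K * norm y \<le> h y"
    using convex_linear_lower_bound[OF h] by metis
  \<comment> \<open>From this radius on, the quadratic term outweighs
    \<open>(4 * K + norm q) * norm y\<close>. Half of \<open>4 * K\<close> pays for the linear lower
    bound; the rest lifts \<open>F y\<close> to at least \<open>K\<close>, hence above
    \<open>F 0\<close>.\<close>
  define R where "R = 1 + 2 * (4 * K + norm q) / \<beta>"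
  have R: "R \<ge> 1" using K \<beta> by (simp add: R_def)
  have far: "F 0 \<le> F y" if "R \<le> norm y" for y
  proof -
    define s where "s = norm y"
    have s: "1 \<le> s" "R \<le> s" using that R by (simp_all add: s_def)
    have "2 * (4 * K + norm q) / \<beta> \<le> s" using s by (simp add: R_def)
    then have "4 * K + norm q \<le> \<beta> / 2 * s" using \<beta> by (simp add: field_simps)
    then have "s * (4 * K + norm q) \<le> s * (\<beta> / 2 * s)" using s by (intro mult_left_mono) auto
    moreover have "2 * K \<le> 2 * K * s" using s K(1) by (simp add: mult_le_cancel_left1)
    moreover have "q \<bullet> y \<le> norm q * s" by (simp add: s_def norm_cauchy_schwarz)
    ultimately have "K \<le> F y"
      using K(3)[of y] by (simp add: F_eq s_def[symmetric] power2_eq_square algebra_simps)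
    moreover have "F 0 \<le> K" using K(2)[of 0] by (simp add: F_eq)
    ultimately show ?thesis by simp
  qed
  have "\<exists>m\<in>cball 0 R. \<forall>y\<in>cball 0 R. F m \<le> F y"
    using R by (intro continuous_attains_inf F_cont) auto
  then obtain m where "\<forall>y\<in>cball 0 R. F m \<le> F y" by blast
  then have m: "F m \<le> F y" if "norm y \<le> R" for y using that by simp
  have min: "F m \<le> F y" for y
    using m[of y] m[of 0] far[of y] R by (cases "norm y \<le> R") auto
  have "F m + \<beta> / 2 * (norm (y - m))\<^sup>2 \<le> F y" for y
  proof -
    \<comment> \<open>Division by \<open>t\<close> leaves the factor \<open>s = 1 - t\<close>;
      letting \<open>s\<close> tend to \<open>1\<close> moves the comparison point into
      \<open>m\<close> and gives the full constant.\<close>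
    have "s * (\<beta> / 2 * (norm (y - m))\<^sup>2) \<le> F y - F m" if s: "0 < s" "s < 1" for s
    proof -
      define t where "t = 1 - s"
      have t: "0 < t" "t < 1" using s by (simp_all add: t_def)
      define z where "z = (1 - t) *\<^sub>R m + t *\<^sub>R y"
      have "h z \<le> (1 - t) * h m + t * h y"
        unfolding z_def using t by (intro convex_onD[OF h]) auto
      moreover have sq: "(norm z)\<^sup>2 = (1 - t) * (norm m)\<^sup>2 + t * (norm y)\<^sup>2 - t * (1 - t) * (norm (y - m))\<^sup>2"
        unfolding z_def power2_norm_eq_inner
        by (simp add: inner_add_left inner_add_right inner_diff_left inner_diff_right inner_commute algebra_simps)
      moreover have "\<beta> / 2 * (norm z)\<^sup>2 = (1 - t) * (\<beta> / 2 * (norm m)\<^sup>2) + t * (\<beta> / 2 * (norm y)\<^sup>2)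
          - t * ((1 - t) * (\<beta> / 2 * (norm (y - m))\<^sup>2))"
        unfolding sq by (simp add: field_simps)
      moreover have "q \<bullet> z = (1 - t) * (q \<bullet> m) + t * (q \<bullet> y)" by (simp add: z_def inner_add_right)
      ultimately have "F z \<le> (1 - t) * F m + t * F y - t * ((1 - t) * (\<beta> / 2 * (norm (y - m))\<^sup>2))"
        unfolding F_eq by argo
      with min[of z] have "t * (s * (\<beta> / 2 * (norm (y - m))\<^sup>2)) \<le> t * (F y - F m)"
        by (simp add: t_def algebra_simps)
      then show ?thesis using t by simp
    qed
    then have "\<beta> / 2 * (norm (y - m))\<^sup>2 \<le> F y - F m" by (rule field_le_mult_one_interval)
    then show ?thesis by simp
  qed
  then show ?thesis using that[of m] by (simp add: F_def)
qed

text \<open>\<open>T\<close> is the gradient of the conjugate of \<psi>. Adding the growth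
  inequalities at two slopes makes it Lipschitz with constant \<open>1 / \<beta>\<close>; continuity
  is what makes the composition with \<open>Q\<close> measurable.\<close>

lemma strongly_convex_argmax:
  fixes \<psi> :: "'b::euclidean_space \<Rightarrow> real"
  assumes \<beta>: "\<beta> > 0" and sc: "strongly_convex \<beta> \<psi>"
  obtains T where "continuous_on UNIV T"
    "\<And>q y. q \<bullet> y - \<psi> y + \<beta> / 2 * (norm (y - T q))\<^sup>2 \<le> q \<bullet> T q - \<psi> (T q)"
proof -
  have "\<exists>m. \<forall>y. \<psi> m - q \<bullet> m + \<beta> / 2 * (norm (y - m))\<^sup>2 \<le> \<psi> y - q \<bullet> y" for q
    using strongly_convex_minimizer[OF assms] by metis
  then obtain T where T: "\<And>q y. \<psi> (T q) - q \<bullet> T q + \<beta> / 2 * (norm (y - T q))\<^sup>2 \<le> \<psi> y - q \<bullet> y"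
    by metis
  have "norm (T p - T q) \<le> (1 / \<beta>) * norm (p - q)" for p q
  proof -
    have "\<beta> * (norm (T p - T q))\<^sup>2 \<le> (p - q) \<bullet> (T p - T q)"
      using T[of p "T q"] T[of q "T p"] by (simp add: norm_minus_commute inner_diff_left inner_diff_right)
    also have "\<dots> \<le> norm (p - q) * norm (T p - T q)" by (rule norm_cauchy_schwarz)
    finally have "norm (T p - T q) * (\<beta> * norm (T p - T q)) \<le> norm (T p - T q) * norm (p - q)"
      by (simp add: power2_eq_square mult_ac)
    then show ?thesis using \<beta> by (cases "T p = T q") (auto simp: field_simps)
  qed
  then have "(1 / \<beta>)-lipschitz_on UNIV T"
    using \<beta> by (intro lipschitz_onI) (auto simp: dist_norm)
  then have "continuous_on UNIV T" by (rule lipschitz_on_continuous_on)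
  moreover have "q \<bullet> y - \<psi> y + \<beta> / 2 * (norm (y - T q))\<^sup>2 \<le> q \<bullet> T q - \<psi> (T q)" for q y
    using T[of q y] by simp
  ultimately show ?thesis by (rule that)
qed

section \<open>Integrals with extended real values\<close>

lemma ext_integral_eq_integral:
  assumes "integrable M f" shows "ext_integral M f = ereal (\<integral>x. f x \<partial>M)"
proof -
  have "(\<integral>\<^sup>+ x. ennreal (f x) \<partial>M) < \<infinity>" "(\<integral>\<^sup>+ x. ennreal (- f x) \<partial>M) < \<infinity>"
    using assms by (auto simp: real_integrable_def less_top)
  then obtain a b where ab: "(\<integral>\<^sup>+ x. ennreal (f x) \<partial>M) = ennreal a" "0 \<le> a"
    "(\<integral>\<^sup>+ x. ennreal (- f x) \<partial>M) = ennreal b" "0 \<le> b"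
    by (metis ennreal_cases infinity_ennreal_def less_irrefl)
  then show ?thesis
    by (simp add: ext_integral_def real_lebesgue_integral_def[OF assms] enn2ereal_ennreal)
qed

lemma ext_integral_mono_AE:
  assumes "AE x in M. f x \<le> g x" shows "ext_integral M f \<le> ext_integral M g"
  unfolding ext_integral_def
  using assms by (intro ereal_minus_mono) (auto simp: less_eq_ennreal.rep_eq[symmetric] intro!: nn_integral_mono_AE ennreal_leI elim: eventually_mono)

text \<open>Being below \<open>g\<close>, the function \<open>f\<close> has an integrable positive
  part. So either it is integrable and the integrals subtract, or its extended integral is minus
  infinity and the right-hand side is infinite.\<close>

lemma nn_integral_gap_le_ext_integral:
  assumes [measurable]: "f \<in> borel_measurable M" "h \<in> borel_measurable M" and g: "integrable M g"
    and h: "\<And>x. 0 \<le> h x" and le: "\<And>x. f x + h x \<le> g x"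
  shows "enn2ereal (\<integral>\<^sup>+ x. ennreal (h x) \<partial>M) \<le> ereal (\<integral>x. g x \<partial>M) - ext_integral M f"
proof (cases "(\<integral>\<^sup>+ x. ennreal (- f x) \<partial>M) = \<infinity>")
  have fg: "f x \<le> g x" for x using le[of x] h[of x] by simp
  have pos: "(\<integral>\<^sup>+ x. ennreal (f x) \<partial>M) \<noteq> \<infinity>"
    using nn_integral_mono[of M "\<lambda>x. ennreal (f x)" "\<lambda>x. ennreal (g x)"] fg g
    by (auto simp: ennreal_leI real_integrable_def top_unique)
  {
    case True
    obtain a where "(\<integral>\<^sup>+ x. ennreal (f x) \<partial>M) = ennreal a" "0 \<le> a"
      using pos by (metis ennreal_cases infinity_ennreal_def)
    then have "ext_integral M f = -\<infinity>" using True by (simp add: ext_integral_def enn2ereal_ennreal)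
    then show ?thesis by simp
  next
    case False
    with pos have f: "integrable M f" by (simp add: real_integrable_def)
    have "(\<integral>\<^sup>+ x. ennreal (h x) \<partial>M) \<le> (\<integral>\<^sup>+ x. ennreal (g x - f x) \<partial>M)"
      using le by (intro nn_integral_mono ennreal_leI) (simp add: algebra_simps)
    also have "\<dots> = ennreal (\<integral>x. g x - f x \<partial>M)"
      using f g fg by (intro nn_integral_eq_integral) auto
    also have "(\<integral>x. g x - f x \<partial>M) = (\<integral>x. g x \<partial>M) - (\<integral>x. f x \<partial>M)" using f g by simp
    finally have "enn2ereal (\<integral>\<^sup>+ x. ennreal (h x) \<partial>M) \<le> enn2ereal (ennreal ((\<integral>x. g x \<partial>M) - (\<integral>x. f x \<partial>M)))"
      by (simp add: less_eq_ennreal.rep_eq)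
    moreover have "(\<integral>x. f x \<partial>M) \<le> (\<integral>x. g x \<partial>M)" using f g fg by (intro integral_mono)
    ultimately show ?thesis by (simp add: ext_integral_eq_integral[OF f] enn2ereal_ennreal)
  }
qed

section \<open>Duality and the error bound\<close>

lemma integrable_sandwich:
  fixes f :: "'a \<Rightarrow> real"
  assumes [measurable]: "f \<in> borel_measurable M" and "integrable M l" "integrable M u"
    and "AE x in M. l x \<le> f x" "AE x in M. f x \<le> u x"
  shows "integrable M f"
proof (rule Bochner_Integration.integrable_bound)
  show "integrable M (\<lambda>x. \<bar>l x\<bar> + \<bar>u x\<bar>)" using assms by simp
  show "AE x in M. norm (f x) \<le> norm (\<bar>l x\<bar> + \<bar>u x\<bar>)"
    using assms(4,5) by eventually_elim simp
qed simp

text \<open>Finite convex functions on the whole space are continuous; this makes the conjugate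
  potential Borel although the supremum may be uncountable.\<close>

lemma convex_on_SUP_affine:
  fixes a :: "'i \<Rightarrow> 'b::euclidean_space" and b :: "'i \<Rightarrow> real"
  assumes "I \<noteq> {}" and bdd: "\<And>y. bdd_above ((\<lambda>i. a i \<bullet> y + b i) ` I)"
  shows "convex_on UNIV (\<lambda>y. SUP i\<in>I. a i \<bullet> y + b i)"
proof (rule convex_onI)
  fix s :: real and x y :: 'b
  assume s: "0 < s" "s < 1"
  show "(SUP i\<in>I. a i \<bullet> ((1 - s) *\<^sub>R x + s *\<^sub>R y) + b i)
    \<le> (1 - s) * (SUP i\<in>I. a i \<bullet> x + b i) + s * (SUP i\<in>I. a i \<bullet> y + b i)"
  proof (rule cSUP_least[OF assms(1)])
    fix i assume i: "i \<in> I"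
    have "a i \<bullet> ((1 - s) *\<^sub>R x + s *\<^sub>R y) + b i = (1 - s) * (a i \<bullet> x + b i) + s * (a i \<bullet> y + b i)"
      by (simp add: inner_add_right algebra_simps)
    also have "\<dots> \<le> (1 - s) * (SUP i\<in>I. a i \<bullet> x + b i) + s * (SUP i\<in>I. a i \<bullet> y + b i)"
      using s by (intro add_mono mult_left_mono cSUP_upper[OF i bdd]) auto
    finally show "a i \<bullet> ((1 - s) *\<^sub>R x + s *\<^sub>R y) + b i
      \<le> (1 - s) * (SUP i\<in>I. a i \<bullet> x + b i) + s * (SUP i\<in>I. a i \<bullet> y + b i)" .
  qed
qed simp

text \<open>The conjugate of Rockafellar's potential \<open>\<phi>\<close> may be infinite on a null set of \<open>\<nu>\<close>, whereas
  admissible potentials are finite. The conjugate of \<open>\<phi> + t * norm ^ 2\<close> is finite, and its dual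
  value exceeds the optimal one by at most \<open>t\<close> times the second moment of \<open>Q\<close>.\<close>

lemma optimal_map_dual_value:
  fixes Q T :: "'a \<Rightarrow> 'b::euclidean_space"
  assumes \<mu>: "prob_space \<mu>" and Q: "sq_integrable \<mu> Q" and T: "sq_integrable \<mu> T"
    and \<nu>: "sets \<nu> = sets borel" "distr \<mu> \<nu> T = \<nu>"
    and opt: "optimal_plan (embedded_cost Q) \<mu> \<nu> (distr \<mu> (\<mu> \<Otimes>\<^sub>M \<nu>) (\<lambda>x. (x, T x)))"
  shows "(INF \<psi>\<in>admissible_potentials \<nu>. sup_lagrangian Q \<mu> \<nu> \<psi>) \<le> ereal (\<integral>x. Q x \<bullet> T x \<partial>\<mu>)"
proof -
  interpret prob_space \<mu> by fact
  have QT_meas[measurable]: "Q \<in> borel_measurable \<mu>" "T \<in> borel_measurable \<mu>"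
    using Q T by (simp_all add: sq_integrable_def)
  have T\<nu>[measurable]: "T \<in> measurable \<mu> \<nu>" by (simp add: measurable_cong_sets[OF refl \<nu>(1)])
  define \<Gamma> where "\<Gamma> = {z. \<forall>e>0. 0 < emeasure \<mu> {x \<in> space \<mu>. dist (Q x, T x) z < e}}"
  have "integrable \<mu> (\<lambda>x. (norm (Q x - T x))\<^sup>2 / 2)"
    using sq_integrable_diff[OF Q T] by (simp add: sq_integrable_def)
  then have "(\<integral>\<^sup>+ x. embedded_cost Q x (T x) \<partial>\<mu>) < \<infinity>"
    by (simp add: embedded_cost_def integrable_iff_bounded)
  then have cm: "cyclically_monotone \<Gamma>"
    unfolding \<Gamma>_def by (rule optimal_map_cyclically_monotone[OF \<mu> QT_meas \<nu> opt])
  have AE_\<Gamma>: "AE x in \<mu>. (Q x, T x) \<in> \<Gamma>"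
    unfolding \<Gamma>_def mem_Collect_eq by (rule AE_in_support) measurable
  have "\<Gamma> \<noteq> {}"
  proof
    assume "\<Gamma> = {}"
    with AE_\<Gamma> have "AE x in \<mu>. False" by simp
    then show False by simp
  qed
  then obtain q0 y0 where z0: "(q0, y0) \<in> \<Gamma>" by auto
  obtain \<phi> :: "'b \<Rightarrow> ereal" where \<phi>: "\<phi> \<in> borel_measurable borel"
    "\<And>q. ereal (y0 \<bullet> (q - q0)) \<le> \<phi> q" "\<And>q y. (q, y) \<in> \<Gamma> \<Longrightarrow> \<phi> q < \<infinity>"
    "\<And>q y q'. (q, y) \<in> \<Gamma> \<Longrightarrow> \<phi> q + ereal (y \<bullet> (q' - q)) \<le> \<phi> q'"
    using cyclically_monotone_potential[OF cm z0] by auto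
  note [measurable] = \<phi>(1)
  define S where "S = fst ` \<Gamma>"
  have q0: "q0 \<in> S" using z0 by (force simp: S_def)
  \<comment> \<open>On \<open>S\<close> the potential \<phi> is finite, from below by its affine
    minorant and from above by cyclical monotonicity; only there does \<open>f\<close> represent
    it.\<close>
  define f where "f q = real_of_ereal (\<phi> q)" for q
  have [measurable]: "f \<in> borel_measurable borel" unfolding f_def by measurable
  have f: "\<phi> q = ereal (f q)" if "q \<in> S" for q
    using that \<phi>(2)[of q] \<phi>(3)[of q] by (cases "\<phi> q") (auto simp: S_def f_def)
  have f_lower: "y0 \<bullet> (q - q0) \<le> f q" if "q \<in> S" for q
    using \<phi>(2)[of q] f[OF that] by simp
  have f_subgradient: "f q + y \<bullet> (q' - q) \<le> f q'" if "(q, y) \<in> \<Gamma>" "q' \<in> S" for q y q'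
  proof -
    have "q \<in> S" using that(1) by (force simp: S_def)
    then show ?thesis using \<phi>(4)[OF that(1), of q'] f[OF that(2)] f[of q] by simp
  qed
  define m where "m = (\<integral>x. (norm (Q x))\<^sup>2 \<partial>\<mu>)"
  have m: "0 \<le> m" by (simp add: m_def)
  have Q2: "integrable \<mu> (\<lambda>x. (norm (Q x))\<^sup>2)" using Q by (simp add: sq_integrable_def)
  have bound: "(INF \<psi>\<in>admissible_potentials \<nu>. sup_lagrangian Q \<mu> \<nu> \<psi>)
    \<le> ereal ((\<integral>x. Q x \<bullet> T x \<partial>\<mu>) + t * m)" if t: "t > 0" for t
  proof -
    define b where "b q = - f q - t * (norm q)\<^sup>2" for q
    define \<psi> where "\<psi> y = (SUP q\<in>S. q \<bullet> y + b q)" for y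
    have bdd: "bdd_above ((\<lambda>q. q \<bullet> y + b q) ` S)" for y
    proof (rule bdd_aboveI2)
      fix q assume q: "q \<in> S"
      \<comment> \<open>Completing the square: the penalty \<open>t * (norm q)\<^sup>2\<close>
        absorbs the linear term \<open>q \<bullet> d\<close> at the price of
        \<open>(norm d)\<^sup>2 / (4 * t)\<close>.\<close>
      define d where "d = y - y0"
      have "0 \<le> t * (norm (q - (1 / (2 * t)) *\<^sub>R d))\<^sup>2" using t by simp
      also have "\<dots> = t * (norm q)\<^sup>2 - q \<bullet> d + (norm d)\<^sup>2 / (4 * t)"
        using t unfolding power2_norm_eq_inner
        by (simp add: inner_diff inner_commute field_simps power2_eq_square)
      finally show "q \<bullet> y + b q \<le> y0 \<bullet> q0 + (norm d)\<^sup>2 / (4 * t)"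
        using f_lower[OF q] by (simp add: b_def d_def inner_diff inner_commute)
    qed
    have \<psi>_upper: "q \<bullet> y + b q \<le> \<psi> y" if "q \<in> S" for q y
      unfolding \<psi>_def by (rule cSUP_upper[OF that bdd])
    have "convex_on UNIV \<psi>"
      unfolding \<psi>_def[abs_def] using q0 by (intro convex_on_SUP_affine bdd) auto
    then have [measurable]: "\<psi> \<in> borel_measurable borel"
      by (intro borel_measurable_continuous_onI convex_on_continuous) auto
    have I: "integrable \<mu> (\<lambda>x. Q x \<bullet> T x)" "integrable \<mu> Q" "integrable \<mu> T"
      using Q T by (auto intro: integrable_inner_sq_integrable sq_integrable_integrable)
    have AE_S: "AE x in \<mu>. Q x \<in> S" using AE_\<Gamma> by eventually_elim (force simp: S_def)
    \<comment> \<open>The subgradient inequality on \<Gamma> controls the conjugate without penalty,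
      and the penalty only lowers it.\<close>
    have sum_le: "AE x in \<mu>. f (Q x) + \<psi> (T x) \<le> Q x \<bullet> T x"
      using AE_\<Gamma>
    proof eventually_elim
      case (elim x)
      have "\<psi> (T x) \<le> Q x \<bullet> T x - f (Q x)"
        unfolding \<psi>_def
      proof (rule cSUP_least)
        show "q \<bullet> T x + b q \<le> Q x \<bullet> T x - f (Q x)" if "q \<in> S" for q
        proof -
          have "0 \<le> t * (norm q)\<^sup>2" using t by simp
          then show ?thesis using f_subgradient[OF elim that] by (simp add: b_def inner_diff inner_commute)
        qed
      qed (use q0 in auto)
      then show ?case by simp
    qed
    \<comment> \<open>The lower bound is one affine function from the supremum, the upper one
      combines \<open>sum_le\<close> with the affine minorant of \<open>f\<close>.\<close>
    have \<psi>T: "integrable \<mu> (\<lambda>x. \<psi> (T x))"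
    proof (rule integrable_sandwich)
      show "integrable \<mu> (\<lambda>x. q0 \<bullet> T x + b q0)" using I by simp
      show "integrable \<mu> (\<lambda>x. Q x \<bullet> T x - y0 \<bullet> (Q x - q0))" using I by simp
      show "AE x in \<mu>. q0 \<bullet> T x + b q0 \<le> \<psi> (T x)" using \<psi>_upper[OF q0] by simp
      show "AE x in \<mu>. \<psi> (T x) \<le> Q x \<bullet> T x - y0 \<bullet> (Q x - q0)"
        using sum_le AE_S by eventually_elim (use f_lower in fastforce)
    qed measurable
    have fQ: "integrable \<mu> (\<lambda>x. f (Q x))"
    proof (rule integrable_sandwich)
      show "integrable \<mu> (\<lambda>x. y0 \<bullet> (Q x - q0))" using I by simp
      show "integrable \<mu> (\<lambda>x. Q x \<bullet> T x - \<psi> (T x))" using I \<psi>T by simp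
      show "AE x in \<mu>. y0 \<bullet> (Q x - q0) \<le> f (Q x)"
        using AE_S by eventually_elim (rule f_lower)
      show "AE x in \<mu>. f (Q x) \<le> Q x \<bullet> T x - \<psi> (T x)" using sum_le by eventually_elim simp
    qed measurable
    have \<psi>\<nu>[measurable]: "\<psi> \<in> borel_measurable \<nu>" by (simp add: measurable_cong_sets[OF \<nu>(1) refl])
    have "integrable (distr \<mu> \<nu> T) \<psi>" using \<psi>T by (simp add: integrable_distr_eq)
    then have "\<psi> \<in> admissible_potentials \<nu>" by (simp add: admissible_potentials_def \<nu>(2))
    moreover have int_\<psi>: "(\<integral>y. \<psi> y \<partial>\<nu>) = (\<integral>x. \<psi> (T x) \<partial>\<mu>)"
      using integral_distr[OF T\<nu> \<psi>\<nu>] by (simp add: \<nu>(2))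
    have "sup_lagrangian Q \<mu> \<nu> \<psi> \<le> ereal ((\<integral>x. Q x \<bullet> T x \<partial>\<mu>) + t * m)"
      unfolding sup_lagrangian_def
    proof (rule SUP_least)
      fix G
      \<comment> \<open>Testing the supremum in \<psi> with the slope \<open>Q x\<close> bounds the
        integrand for every \<open>G\<close> at once.\<close>
      have "ext_integral \<mu> (\<lambda>x. Q x \<bullet> G x - \<psi> (G x)) \<le> ext_integral \<mu> (\<lambda>x. f (Q x) + t * (norm (Q x))\<^sup>2)"
      proof (rule ext_integral_mono_AE)
        show "AE x in \<mu>. Q x \<bullet> G x - \<psi> (G x) \<le> f (Q x) + t * (norm (Q x))\<^sup>2"
          using AE_S
        proof eventually_elim
          case (elim x)
          then show ?case using \<psi>_upper[of "Q x" "G x"] by (simp add: b_def)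
        qed
      qed
      also have "\<dots> = ereal ((\<integral>x. f (Q x) \<partial>\<mu>) + t * m)"
        using fQ Q2 by (simp add: ext_integral_eq_integral m_def)
      finally have "lagrangian Q \<mu> \<nu> \<psi> G \<le> ereal ((\<integral>x. f (Q x) \<partial>\<mu>) + t * m) + ereal (\<integral>x. \<psi> (T x) \<partial>\<mu>)"
        unfolding lagrangian_def int_\<psi> by (rule add_right_mono)
      moreover have "(\<integral>x. f (Q x) + \<psi> (T x) \<partial>\<mu>) \<le> (\<integral>x. Q x \<bullet> T x \<partial>\<mu>)"
        using fQ \<psi>T I sum_le by (intro integral_mono_AE) auto
      ultimately show "lagrangian Q \<mu> \<nu> \<psi> G \<le> ereal ((\<integral>x. Q x \<bullet> T x \<partial>\<mu>) + t * m)"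
        using fQ \<psi>T by (elim order_trans) simp
    qed
    ultimately show ?thesis by (rule INF_lower2[of \<psi> _ "sup_lagrangian Q \<mu> \<nu>"])
  qed
  show ?thesis
  proof (rule ereal_le_epsilon2)
    fix e :: real assume e: "0 < e"
    define t where "t = e / (m + 1)"
    have "t > 0" using e m by (simp add: t_def)
    moreover have "t * m \<le> e" using e m by (simp add: t_def field_simps)
    ultimately show "(INF \<psi>\<in>admissible_potentials \<nu>. sup_lagrangian Q \<mu> \<nu> \<psi>)
        \<le> ereal (\<integral>x. Q x \<bullet> T x \<partial>\<mu>) + ereal e"
      by (intro order_trans[OF bound[of t]]) simp_all
  qed
qed

section \<open>The error bound\<close>

text \<open>Minkowski's inequality in squared form, the cross term being handled by Cauchy-Schwarz.
  The hypotheses force \<open>e1\<close> and \<open>e2\<close> to be nonnegative, so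
  \<open>ereal_sqrt\<close> is evaluated where it is a genuine root.\<close>

lemma nn_integral_norm_diff_sq_le:
  fixes u v :: "'a \<Rightarrow> 'b::euclidean_space"
  assumes [measurable]: "u \<in> borel_measurable M" "v \<in> borel_measurable M" and \<beta>: "\<beta> > 0"
    and u: "enn2ereal (\<integral>\<^sup>+ x. ennreal (\<beta> / 2 * (norm (u x))\<^sup>2) \<partial>M) \<le> e1"
    and v: "enn2ereal (\<integral>\<^sup>+ x. ennreal (\<beta> / 2 * (norm (v x))\<^sup>2) \<partial>M) \<le> e2"
  shows "enn2ereal (\<integral>\<^sup>+ x. ennreal ((norm (u x - v x))\<^sup>2) \<partial>M)
    \<le> ereal (2 / \<beta>) * (ereal_sqrt e1 + ereal_sqrt e2)\<^sup>2"
proof (cases "e1 = \<infinity> \<or> e2 = \<infinity>")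
  case True
  then have inf: "ereal_sqrt e1 + ereal_sqrt e2 = \<infinity>" by (auto simp: ereal_sqrt_def)
  show ?thesis unfolding inf using \<beta> by (simp add: power2_eq_square)
next
  case False
  have bound: "sq_integrable M w \<and> (\<exists>r. e = ereal r \<and> \<beta> / 2 * (\<integral>x. (norm (w x))\<^sup>2 \<partial>M) \<le> r)"
    if [measurable]: "w \<in> borel_measurable M" and e: "e \<noteq> \<infinity>"
      and w: "enn2ereal (\<integral>\<^sup>+ x. ennreal (\<beta> / 2 * (norm (w x))\<^sup>2) \<partial>M) \<le> e" for w :: "'a \<Rightarrow> 'b" and e
  proof -
    have "0 \<le> e" using w enn2ereal_nonneg order_trans by blast
    with e obtain r where r: "e = ereal r" "0 \<le> r" by (cases e) auto
    have "(\<integral>\<^sup>+ x. ennreal (\<beta> / 2 * (norm (w x))\<^sup>2) \<partial>M) \<le> ennreal r"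
      using w r by (simp add: less_eq_ennreal.rep_eq enn2ereal_ennreal)
    then have "integrable M (\<lambda>x. \<beta> / 2 * (norm (w x))\<^sup>2)"
      using \<beta> by (auto simp: integrable_iff_bounded abs_mult le_less_trans)
    then have "integrable M (\<lambda>x. 2 / \<beta> * (\<beta> / 2 * (norm (w x))\<^sup>2))" by (rule integrable_mult_right)
    then have sq: "sq_integrable M w" using \<beta> by (simp add: sq_integrable_def)
    moreover have "\<beta> / 2 * (\<integral>x. (norm (w x))\<^sup>2 \<partial>M) \<le> r"
    proof -
      have "ennreal (\<integral>x. \<beta> / 2 * (norm (w x))\<^sup>2 \<partial>M) \<le> ennreal r"
        using \<open>_ \<le> ennreal r\<close> \<open>integrable M (\<lambda>x. \<beta> / 2 * (norm (w x))\<^sup>2)\<close> \<beta>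
        by (subst nn_integral_eq_integral[symmetric]) auto
      then show ?thesis using r(2) by (simp add: ennreal_le_iff)
    qed
    ultimately show ?thesis using r(1) by blast
  qed
  from bound[OF _ _ u] False obtain r1 where r1: "sq_integrable M u" "e1 = ereal r1"
    "\<beta> / 2 * (\<integral>x. (norm (u x))\<^sup>2 \<partial>M) \<le> r1" by auto
  from bound[OF _ _ v] False obtain r2 where r2: "sq_integrable M v" "e2 = ereal r2"
    "\<beta> / 2 * (\<integral>x. (norm (v x))\<^sup>2 \<partial>M) \<le> r2" by auto
  define a b where "a = (\<integral>x. (norm (u x))\<^sup>2 \<partial>M)" "b = (\<integral>x. (norm (v x))\<^sup>2 \<partial>M)"
  have ab: "0 \<le> a" "0 \<le> b" by (simp_all add: a_b_def)
  have norms: "sq_integrable M (\<lambda>x. norm (u x))" "sq_integrable M (\<lambda>x. norm (v x))"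
    using r1(1) r2(1) by (simp_all add: sq_integrable_def)
  have prod: "integrable M (\<lambda>x. norm (u x) * norm (v x))"
    using integrable_inner_sq_integrable[OF norms] by simp
  have "(\<integral>x. norm (u x) * norm (v x) \<partial>M)\<^sup>2 \<le> a * b"
    using Cauchy_Schwarz_integral[OF norms] by (simp add: a_b_def power2_eq_square)
  then have cs: "(\<integral>x. norm (u x) * norm (v x) \<partial>M) \<le> sqrt a * sqrt b"
    by (metis real_le_rsqrt real_sqrt_mult)
  have "(\<integral>x. (norm (u x - v x))\<^sup>2 \<partial>M) \<le> (\<integral>x. (norm (u x))\<^sup>2 + 2 * (norm (u x) * norm (v x)) + (norm (v x))\<^sup>2 \<partial>M)"
  proof (rule integral_mono)
    show "integrable M (\<lambda>x. (norm (u x - v x))\<^sup>2)"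
      using sq_integrable_diff[OF r1(1) r2(1)] by (simp add: sq_integrable_def)
    show "integrable M (\<lambda>x. (norm (u x))\<^sup>2 + 2 * (norm (u x) * norm (v x)) + (norm (v x))\<^sup>2)"
      using prod r1(1) r2(1) by (simp add: sq_integrable_def)
    show "(norm (u x - v x))\<^sup>2 \<le> (norm (u x))\<^sup>2 + 2 * (norm (u x) * norm (v x)) + (norm (v x))\<^sup>2" for x
      using power_mono[OF norm_triangle_ineq4[of "u x" "v x"], of 2]
      by (simp add: power2_sum mult.assoc)
  qed
  also have "\<dots> = a + 2 * (\<integral>x. norm (u x) * norm (v x) \<partial>M) + b"
    using prod r1(1) r2(1) by (simp add: sq_integrable_def a_b_def)
  also have "\<dots> \<le> (sqrt a + sqrt b)\<^sup>2"
    using cs ab by (simp add: power2_sum)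
  also have "\<dots> \<le> (sqrt (2 / \<beta> * r1) + sqrt (2 / \<beta> * r2))\<^sup>2"
    using r1(3) r2(3) \<beta> ab
    by (intro power_mono add_mono real_sqrt_le_mono) (auto simp: a_b_def field_simps)
  also have "\<dots> = 2 / \<beta> * (sqrt r1 + sqrt r2)\<^sup>2"
  proof -
    have "sqrt (2 / \<beta> * r1) + sqrt (2 / \<beta> * r2) = sqrt (2 / \<beta>) * (sqrt r1 + sqrt r2)"
      by (simp only: real_sqrt_mult distrib_left)
    then show ?thesis using \<beta> by (simp only: power_mult_distrib) simp
  qed
  finally have le: "(\<integral>x. (norm (u x - v x))\<^sup>2 \<partial>M) \<le> 2 / \<beta> * (sqrt r1 + sqrt r2)\<^sup>2" .
  have "(\<integral>\<^sup>+ x. ennreal ((norm (u x - v x))\<^sup>2) \<partial>M) = ennreal (\<integral>x. (norm (u x - v x))\<^sup>2 \<partial>M)"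
    using sq_integrable_diff[OF r1(1) r2(1)]
    by (intro nn_integral_eq_integral) (simp_all add: sq_integrable_def)
  then show ?thesis
    using le by (simp add: enn2ereal_ennreal ereal_sqrt_def r1(2) r2(2) power2_eq_square)
qed

lemma saddle_point_error_bound:
  fixes Q T G :: "'a \<Rightarrow> 'b::euclidean_space"
  assumes \<mu>: "prob_space \<mu>" and Q: "sq_integrable \<mu> Q" and T: "sq_integrable \<mu> T"
    and \<nu>: "sets \<nu> = sets borel" "distr \<mu> \<nu> T = \<nu>"
    and opt: "optimal_plan (embedded_cost Q) \<mu> \<nu> (distr \<mu> (\<mu> \<Otimes>\<^sub>M \<nu>) (\<lambda>x. (x, T x)))"
    and \<psi>: "\<psi> \<in> admissible_potentials \<nu>" and sc: "\<beta> > 0" "strongly_convex \<beta> \<psi>"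
    and G[measurable]: "G \<in> borel_measurable \<mu>"
  shows "enn2ereal (\<integral>\<^sup>+ x. ennreal ((norm (G x - T x))\<^sup>2) \<partial>\<mu>)
    \<le> ereal (2 / \<beta>) * (ereal_sqrt (sup_lagrangian Q \<mu> \<nu> \<psi> - lagrangian Q \<mu> \<nu> \<psi> G)
      + ereal_sqrt (sup_lagrangian Q \<mu> \<nu> \<psi> - (INF \<psi>\<in>admissible_potentials \<nu>. sup_lagrangian Q \<mu> \<nu> \<psi>)))\<^sup>2"
proof -
  interpret prob_space \<mu> by fact
  have [measurable]: "Q \<in> borel_measurable \<mu>" "T \<in> borel_measurable \<mu>"
    using Q T by (simp_all add: sq_integrable_def)
  have T\<nu>[measurable]: "T \<in> measurable \<mu> \<nu>" by (simp add: measurable_cong_sets[OF refl \<nu>(1)])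
  have [measurable]: "\<psi> \<in> borel_measurable borel" using \<psi> by (simp add: admissible_potentials_def)
  then have \<psi>\<nu>: "\<psi> \<in> borel_measurable \<nu>" by (simp add: measurable_cong_sets[OF \<nu>(1) refl])
  obtain P where P_cont: "continuous_on UNIV P"
    and P: "\<And>q y. q \<bullet> y - \<psi> y + \<beta> / 2 * (norm (y - P q))\<^sup>2 \<le> q \<bullet> P q - \<psi> (P q)"
    using strongly_convex_argmax[OF sc] by metis
  have [measurable]: "P \<in> borel_measurable borel" using P_cont by (rule borel_measurable_continuous_onI)
  define G0 where "G0 x = P (Q x)" for x
  have G0[measurable]: "G0 \<in> borel_measurable \<mu>" unfolding G0_def by measurable
  define k where "k x = Q x \<bullet> G0 x - \<psi> (G0 x)" for x
  have k_meas[measurable]: "k \<in> borel_measurable \<mu>" unfolding k_def by measurable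
  \<comment> \<open>Comparison with the constant map \<open>0\<close> bounds the negative part of
    \<open>k\<close>, so \<open>G0\<close> is admissible even if the integral of \<open>k\<close> is
    infinite.\<close>
  have k_ge: "- k x \<le> \<psi> 0" for x
  proof -
    have "0 \<le> \<beta> / 2 * (norm (0 - P (Q x)))\<^sup>2" using sc(1) by simp
    then show ?thesis using P[of "Q x" 0] by (simp add: k_def G0_def)
  qed
  have "(\<integral>\<^sup>+ x. ennreal (- k x) \<partial>\<mu>) \<le> (\<integral>\<^sup>+ x. ennreal (\<psi> 0) \<partial>\<mu>)"
    by (intro nn_integral_mono ennreal_leI k_ge)
  then have k_neg: "(\<integral>\<^sup>+ x. ennreal (- k x) \<partial>\<mu>) < \<infinity>"
    by (simp add: emeasure_space_1 le_less_trans)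
  define c where "c = (\<integral>y. \<psi> y \<partial>\<nu>)"
  define s where "s = sup_lagrangian Q \<mu> \<nu> \<psi>"
  define V where "V = (INF \<psi>\<in>admissible_potentials \<nu>. sup_lagrangian Q \<mu> \<nu> \<psi>)"
  have V: "V \<le> ereal (\<integral>x. Q x \<bullet> T x \<partial>\<mu>)"
    unfolding V_def by (rule optimal_map_dual_value[OF \<mu> Q T \<nu> opt])
  have "G0 \<in> admissible_maps Q \<mu> \<psi>"
    using k_neg k_meas by (simp add: admissible_maps_def quasi_integrable_def k_def G0)
  then have s: "ext_integral \<mu> k + ereal c \<le> s"
    unfolding s_def sup_lagrangian_def by (intro SUP_upper2) (auto simp: lagrangian_def k_def[abs_def] c_def)
  have gaps: "enn2ereal (\<integral>\<^sup>+ x. ennreal (\<beta> / 2 * (norm (G x - G0 x))\<^sup>2) \<partial>\<mu>) \<le> s - lagrangian Q \<mu> \<nu> \<psi> G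
    \<and> enn2ereal (\<integral>\<^sup>+ x. ennreal (\<beta> / 2 * (norm (T x - G0 x))\<^sup>2) \<partial>\<mu>) \<le> s - V"
  proof (cases "(\<integral>\<^sup>+ x. ennreal (k x) \<partial>\<mu>) = \<infinity>")
    \<comment> \<open>Then the supremum is infinite, and so are both upper bounds.\<close>
    case True
    have "ext_integral \<mu> k = \<infinity>" using True k_neg by (simp add: ext_integral_def)
    then have "s = \<infinity>" using s by simp
    then show ?thesis by simp
  next
    case False
    then have k: "integrable \<mu> k" using k_neg by (simp add: real_integrable_def)
    have gap: "enn2ereal (\<integral>\<^sup>+ x. ennreal (\<beta> / 2 * (norm (F x - G0 x))\<^sup>2) \<partial>\<mu>)
        \<le> ereal (\<integral>x. k x \<partial>\<mu>) - ext_integral \<mu> (\<lambda>x. Q x \<bullet> F x - \<psi> (F x))"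
      if [measurable]: "F \<in> borel_measurable \<mu>" for F
    proof (rule nn_integral_gap_le_ext_integral[OF _ _ k])
      show "Q x \<bullet> F x - \<psi> (F x) + \<beta> / 2 * (norm (F x - G0 x))\<^sup>2 \<le> k x" for x
        using P[of "Q x" "F x"] by (simp add: k_def G0_def)
    qed (use sc(1) in auto)
    have s: "ereal ((\<integral>x. k x \<partial>\<mu>) + c) \<le> s" using s by (simp add: ext_integral_eq_integral[OF k])
    have \<psi>T: "integrable \<mu> (\<lambda>x. \<psi> (T x))" "c = (\<integral>x. \<psi> (T x) \<partial>\<mu>)"
      using \<psi> integrable_distr_eq[OF T\<nu> \<psi>\<nu>] integral_distr[OF T\<nu> \<psi>\<nu>]
      by (simp_all add: admissible_potentials_def \<nu>(2) c_def)
    have QT: "integrable \<mu> (\<lambda>x. Q x \<bullet> T x)" by (rule integrable_inner_sq_integrable[OF Q T])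
    have "ereal (\<integral>x. k x \<partial>\<mu>) - ext_integral \<mu> (\<lambda>x. Q x \<bullet> G x - \<psi> (G x)) \<le> s - lagrangian Q \<mu> \<nu> \<psi> G"
      using s unfolding lagrangian_def c_def[symmetric]
      by (cases s; cases "ext_integral \<mu> (\<lambda>x. Q x \<bullet> G x - \<psi> (G x))") auto
    moreover have "ereal (\<integral>x. k x \<partial>\<mu>) - ext_integral \<mu> (\<lambda>x. Q x \<bullet> T x - \<psi> (T x)) \<le> s - V"
    proof -
      \<comment> \<open>The pushforward identity turns \<open>c\<close> into the integral of
        \<open>\<psi> (T x)\<close>, which cancels the potential in the Lagrangian at
        \<open>T\<close>.\<close>
      have "ereal (\<integral>x. k x \<partial>\<mu>) - ext_integral \<mu> (\<lambda>x. Q x \<bullet> T x - \<psi> (T x))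
          = ereal ((\<integral>x. k x \<partial>\<mu>) + c) - ereal (\<integral>x. Q x \<bullet> T x \<partial>\<mu>)"
        using \<psi>T QT by (simp add: ext_integral_eq_integral)
      also have "\<dots> \<le> s - V" using s V by (rule ereal_minus_mono)
      finally show ?thesis .
    qed
    ultimately show ?thesis using gap[OF G] gap[of T] by (meson \<open>T \<in> borel_measurable \<mu>\<close> order_trans)
  qed
  show ?thesis
    \<comment> \<open>Here \<open>u = G - G0\<close> and \<open>v = T - G0\<close>, so that
      \<open>G0\<close> cancels in the difference.\<close>
    using nn_integral_norm_diff_sq_le[OF _ _ sc(1) conjunct1[OF gaps] conjunct2[OF gaps]]
    by (simp add: s_def V_def)
qed

theorem theorem4p3:
  fixes \<mu> :: "(real^'h) measure" and \<nu> :: "(real^'d) measure"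
    and Q Gstar Ghat :: "real^'h \<Rightarrow> real^'d"
    and \<pi>star :: "((real^'h) \<times> (real^'d)) measure"
    and \<psi>hat :: "real^'d \<Rightarrow> real"
    and feat :: "real^'d \<Rightarrow> real^'m"
    and \<beta> L :: real and \<epsilon>1 \<epsilon>2 :: ereal
  assumes "prob_space \<mu>" and "sets \<mu> = sets borel"
    and "prob_space \<nu>" and "sets \<nu> = sets borel"
    and "Q \<in> borel_measurable borel"
    and "finite_second_moment (distr \<mu> borel Q)" and "finite_second_moment \<nu>"
    and "optimal_plan (embedded_cost Q) \<mu> \<nu> \<pi>star"
    and "\<And>\<pi>. optimal_plan (embedded_cost Q) \<mu> \<nu> \<pi> \<Longrightarrow> \<pi> = \<pi>star"
    and "Gstar \<in> borel_measurable borel"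
    and "\<pi>star = distr \<mu> (\<mu> \<Otimes>\<^sub>M \<nu>) (\<lambda>x. (x, Gstar x))"
    and "\<psi>hat \<in> admissible_potentials \<nu>"
    and "\<beta> > 0" and "strongly_convex \<beta> \<psi>hat"
    and "Ghat \<in> borel_measurable borel"
    and "\<epsilon>1 = sup_lagrangian Q \<mu> \<nu> \<psi>hat - lagrangian Q \<mu> \<nu> \<psi>hat Ghat"
    and "\<epsilon>2 = sup_lagrangian Q \<mu> \<nu> \<psi>hat
            - (INF \<psi>\<in>admissible_potentials \<nu>. sup_lagrangian Q \<mu> \<nu> \<psi>)"
    and "L > 0" and "L-lipschitz_on UNIV feat"
  shows "FID feat (distr \<mu> borel Ghat) \<nu> / ereal (L\<^sup>2)
           \<le> 2 * enn2ereal (W2_sq (distr \<mu> borel Ghat) \<nu>)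
       \<and> 2 * enn2ereal (W2_sq (distr \<mu> borel Ghat) \<nu>)
           \<le> enn2ereal (\<integral>\<^sup>+ x. ennreal ((norm (Ghat x - Gstar x))\<^sup>2) \<partial>\<mu>)
       \<and> enn2ereal (\<integral>\<^sup>+ x. ennreal ((norm (Ghat x - Gstar x))\<^sup>2) \<partial>\<mu>)
           \<le> ereal (2 / \<beta>) * (ereal_sqrt \<epsilon>1 + ereal_sqrt \<epsilon>2)\<^sup>2"
proof -
  note prob_\<mu> = assms(1) and sets_\<mu> = assms(2) and prob_\<nu> = assms(3) and sets_\<nu> = assms(4)
  have [measurable]: "Q \<in> borel_measurable \<mu>" "Gstar \<in> borel_measurable \<mu>" "Ghat \<in> borel_measurable \<mu>"
    using assms(5,10,15) by (simp_all add: measurable_cong_sets[OF sets_\<mu> refl])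
  have Gstar\<nu>[measurable]: "Gstar \<in> measurable \<mu> \<nu>" by (simp add: measurable_cong_sets[OF refl sets_\<nu>])
  have opt: "optimal_plan (embedded_cost Q) \<mu> \<nu> (distr \<mu> (\<mu> \<Otimes>\<^sub>M \<nu>) (\<lambda>x. (x, Gstar x)))"
    using assms(8,11) by simp
  \<comment> \<open>The second marginal of the optimal plan says that \<open>Gstar\<close>
    transports \<mu> to \<nu>; its square integrability is therefore the second moment of
    \<nu>.\<close>
  then have "distr (distr \<mu> (\<mu> \<Otimes>\<^sub>M \<nu>) (\<lambda>x. (x, Gstar x))) \<nu> snd = \<nu>"
    by (simp add: optimal_plan_def couplings_def)
  then have push: "distr \<mu> \<nu> Gstar = \<nu>" by (simp add: distr_distr comp_def)
  have push_borel: "\<nu> = distr \<mu> borel Gstar"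
    using push distr_cong[of \<mu> \<mu> \<nu> borel Gstar Gstar] sets_\<nu> by simp
  have sq_Q: "sq_integrable \<mu> Q"
    using assms(6) by (simp add: finite_second_moment_def sq_integrable_iff_nn_integral nn_integral_distr)
  have "(\<integral>\<^sup>+ y. ennreal ((norm y)\<^sup>2) \<partial>distr \<mu> borel Gstar) < \<infinity>"
    using assms(7) push_borel by (simp add: finite_second_moment_def)
  then have sq_Gstar: "sq_integrable \<mu> Gstar"
    by (simp add: sq_integrable_iff_nn_integral nn_integral_distr)
  have "FID feat (distr \<mu> borel Ghat) \<nu> / ereal (L\<^sup>2) \<le> 2 * enn2ereal (W2_sq (distr \<mu> borel Ghat) \<nu>)"
    by (rule FID_le_W2_sq) (simp_all add: assms prob_space.prob_space_distr)
  moreover have "2 * enn2ereal (W2_sq (distr \<mu> borel Ghat) \<nu>)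
      \<le> enn2ereal (\<integral>\<^sup>+ x. ennreal ((norm (Ghat x - Gstar x))\<^sup>2) \<partial>\<mu>)"
    by (rule W2_sq_distr_le) (use sets_\<nu> push_borel in auto)
  moreover have "enn2ereal (\<integral>\<^sup>+ x. ennreal ((norm (Ghat x - Gstar x))\<^sup>2) \<partial>\<mu>)
      \<le> ereal (2 / \<beta>) * (ereal_sqrt \<epsilon>1 + ereal_sqrt \<epsilon>2)\<^sup>2"
    unfolding assms(16,17)
    by (rule saddle_point_error_bound[OF prob_\<mu> sq_Q sq_Gstar sets_\<nu> push opt assms(12-14)]) simp
  ultimately show ?thesis by blast
qed

end
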